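(* Let $\mathbf G$ be a coherent canonical system. Then $\mathbf G$ is strongly decidable: given a finite set $\mathcal S$ of sequents and a sequent $s$, it is decidable whether $\mathcal{S}\vdash^{seq}_{\mathbf G}s$.
   Context: $\mathcal{L}$ is a propositional language with atoms $p_1,p_2,\ldots$ and set of formulas $\mathcal{F}$. A sequent is $\Gamma\Rightarrow E$ with $\Gamma$ a finite set of formulas and $E$ a set of formulas with at most one element. A clause is a sequent of atoms. An $\mathcal{L}$-substitution is a map $\sigma:\mathcal{F}\to\mathcal{F}$ commuting with all connectives, extended pointwise to sets. A canonical right-introduction rule for an $n$-ary connective $\diamond$ is $\{\Pi_i\Rightarrow E_i\}_{1\le i\le m}/\ \Rightarrow\diamond(p_1,\dots,p_n)$ with $m\ge0$ and $\Pi_i\cup E_i\subseteq\{p_1,\dots,p_n\}$; an application infers $\Gamma\Rightarrow\sigma(\diamond(p_1,\dots,p_n))$ from $\Gamma,\sigma(\Pi_i)\Rightarrow\sigma(E_i)$ ($1\le i\le m$), for any finite $\Gamma$ and substitution $\sigma$. A canonical left-introduction rule is $\langle\{\Pi_i\Rightarrow E_i\}_{1\le i\le m},\{\Sigma_j\Rightarrow\}_{1\le j\le k}\rangle/\ \diamond(p_1,\dots,p_n)\Rightarrow$ with all atoms among $p_1,\dots,p_n$; an application infers $\Gamma,\sigma(\diamond(p_1,\dots,p_n))\Rightarrow E$ from $\Gamma,\sigma(\Pi_i)\Rightarrow\sigma(E_i)$ and $\Gamma,\sigma(\Sigma_j)\Rightarrow E$, for any sequent $\Gamma\Rightarrow E$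 and substitution $\sigma$. A canonical system has axioms $\varphi\Rightarrow\varphi$, weakening (from $\Gamma\Rightarrow E$ infer $\Gamma,\Delta\Rightarrow E$; from $\Gamma\Rightarrow$ infer $\Gamma\Rightarrow\psi$), cut (from $\Gamma\Rightarrow\varphi$ and $\Delta,\varphi\Rightarrow E$ infer $\Gamma,\Delta\Rightarrow E$), and a set of canonical right- and left-introduction rules. $\mathcal{S}\vdash^{seq}_{\mathbf G}s$ means $s$ is derivable in $\mathbf G$ from the sequents of $\mathcal S$ as extra axioms. A classical assignment $u$ satisfies a clause $\Pi\Rightarrow E$ iff $u(p)=f$ for some $p\in\Pi$ or $E=\{q\}$ with $u(q)=t$; $\mathbf G$ is coherent iff for every connective $\diamond$, whenever $\mathbf G$ contains a left rule $\langle S_1,S_2\rangle/\diamond(p_1,\dots,p_n)\Rightarrow$ and a right rule $S_3/\Rightarrow\diamond(p_1,\dots,p_n)$, no assignment satisfies all clauses of $S_1\cup S_2\cup S_3$.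
   Formalization: The canonical system G is additionally assumed to be effectively given: it is decidable which canonical rules belong to G. This holds automatically for finitely many connectives or rules; with infinitely many connectives the claim fails without it. *)

theory Defs
  imports Complex_Main "HOL-Library.Nat_Bijection"
begin

section \<open>Languages, formulas, sequents\<close>

text \<open>
  A propositional language is given by the arities of its connectives: \<open>L c = Some n\<close> says
  that \<open>c\<close> is an \<open>n\<close>-ary connective of \<open>L\<close>.  Connectives are named by natural numbers, so that
  formulas are finite objects over which decidability makes sense.  The atoms
  \<open>p\<^sub>1, p\<^sub>2, \<dots>\<close> are \<open>Atom 0, Atom 1, \<dots>\<close>.
\<close>

type_synonym language = "nat \<rightharpoonup> nat"

datatype fm = Atom nat | Con nat "fm list"

inductive_set formulas :: "language \<Rightarrow> fm set" for L where
  Atom: "Atom i \<in> formulas L"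
| Con: "L c = Some (length \<phi>s) \<Longrightarrow> (\<And>\<phi>. \<phi> \<in> set \<phi>s \<Longrightarrow> \<phi> \<in> formulas L) \<Longrightarrow>
    Con c \<phi>s \<in> formulas L"

text \<open>In a sequent \<open>(\<Gamma>, E)\<close>, the option \<open>E\<close> is the right-hand side with at most one element.\<close>

type_synonym seq = "fm set \<times> fm option"

definition sequents :: "language \<Rightarrow> seq set" where
  "sequents L = {(\<Gamma>, E). finite \<Gamma> \<and> \<Gamma> \<subseteq> formulas L \<and> set_option E \<subseteq> formulas L}"

text \<open>Clauses all of whose atoms are among the first \<open>n\<close>.\<close>

definition clauses :: "nat \<Rightarrow> seq set" where
  "clauses n = {(\<Pi>, E). \<Pi> \<subseteq> Atom ` {..<n} \<and> set_option E \<subseteq> Atom ` {..<n}}"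

definition is_subst :: "language \<Rightarrow> (fm \<Rightarrow> fm) \<Rightarrow> bool" where
  "is_subst L \<sigma> \<longleftrightarrow>
     (\<forall>\<phi> \<in> formulas L. \<sigma> \<phi> \<in> formulas L) \<and>
     (\<forall>c \<phi>s. Con c \<phi>s \<in> formulas L \<longrightarrow> \<sigma> (Con c \<phi>s) = Con c (map \<sigma> \<phi>s))"

section \<open>Canonical systems\<close>

text \<open>
  \<open>RightRule c S\<close> is the rule \<open>S / \<Rightarrow> c(p\<^sub>1,\<dots>,p\<^sub>n)\<close>, and
  \<open>LeftRule c S1 S2\<close> is the rule \<open>\<langle>S1, S2\<rangle> / c(p\<^sub>1,\<dots>,p\<^sub>n) \<Rightarrow>\<close>.
\<close>

datatype rule = RightRule nat "seq set" | LeftRule nat "seq set" "seq set"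

fun canonical_rule :: "language \<Rightarrow> rule \<Rightarrow> bool" where
  "canonical_rule L (RightRule c S) \<longleftrightarrow> (\<exists>n. L c = Some n \<and> finite S \<and> S \<subseteq> clauses n)"
| "canonical_rule L (LeftRule c S1 S2) \<longleftrightarrow>
     (\<exists>n. L c = Some n \<and> finite S1 \<and> S1 \<subseteq> clauses n \<and>
       finite S2 \<and> S2 \<subseteq> clauses n \<and> (\<forall>(\<Sigma>, E) \<in> S2. E = None))"

text \<open>A system is identified with its set of logical rules; axioms, weakening and cut are
  built into \<open>derivable\<close>.\<close>

type_synonym system = "rule set"

definition canonical_system :: "language \<Rightarrow> system \<Rightarrow> bool" where
  "canonical_system L G \<longleftrightarrow> (\<forall>r \<in> G. canonical_rule L r)"

inductive derivable :: "language \<Rightarrow> system \<Rightarrow> seq set \<Rightarrow> seq \<Rightarrow> bool" for L G \<S> where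
  hyp: "s \<in> \<S> \<Longrightarrow> derivable L G \<S> s"
| axiom: "\<phi> \<in> formulas L \<Longrightarrow> derivable L G \<S> ({\<phi>}, Some \<phi>)"
| weak_left: "derivable L G \<S> (\<Gamma>, E) \<Longrightarrow> finite \<Delta> \<Longrightarrow> \<Delta> \<subseteq> formulas L \<Longrightarrow>
    derivable L G \<S> (\<Gamma> \<union> \<Delta>, E)"
| weak_right: "derivable L G \<S> (\<Gamma>, None) \<Longrightarrow> \<psi> \<in> formulas L \<Longrightarrow>
    derivable L G \<S> (\<Gamma>, Some \<psi>)"
| cut: "derivable L G \<S> (\<Gamma>, Some \<phi>) \<Longrightarrow> derivable L G \<S> (insert \<phi> \<Delta>, E) \<Longrightarrow>
    derivable L G \<S> (\<Gamma> \<union> \<Delta>, E)"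
| right: "RightRule c S \<in> G \<Longrightarrow> L c = Some n \<Longrightarrow> is_subst L \<sigma> \<Longrightarrow>
    finite \<Gamma> \<Longrightarrow> \<Gamma> \<subseteq> formulas L \<Longrightarrow>
    (\<And>\<Pi> F. (\<Pi>, F) \<in> S \<Longrightarrow> derivable L G \<S> (\<Gamma> \<union> \<sigma> ` \<Pi>, map_option \<sigma> F)) \<Longrightarrow>
    derivable L G \<S> (\<Gamma>, Some (\<sigma> (Con c (map Atom [0..<n]))))"
| left: "LeftRule c S1 S2 \<in> G \<Longrightarrow> L c = Some n \<Longrightarrow> is_subst L \<sigma> \<Longrightarrow>
    (\<Gamma>, E) \<in> sequents L \<Longrightarrow>
    (\<And>\<Pi> F. (\<Pi>, F) \<in> S1 \<Longrightarrow> derivable L G \<S> (\<Gamma> \<union> \<sigma> ` \<Pi>, map_option \<sigma> F)) \<Longrightarrow>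
    (\<And>\<Sigma>. (\<Sigma>, None) \<in> S2 \<Longrightarrow> derivable L G \<S> (\<Gamma> \<union> \<sigma> ` \<Sigma>, E)) \<Longrightarrow>
    derivable L G \<S> (insert (\<sigma> (Con c (map Atom [0..<n]))) \<Gamma>, E)"

definition satisfies :: "(nat \<Rightarrow> bool) \<Rightarrow> seq \<Rightarrow> bool" where
  "satisfies u cl \<longleftrightarrow>
     (\<exists>i. Atom i \<in> fst cl \<and> \<not> u i) \<or> (\<exists>i. snd cl = Some (Atom i) \<and> u i)"

definition coherent :: "system \<Rightarrow> bool" where
  "coherent G \<longleftrightarrow>
     (\<forall>c S1 S2 S3. LeftRule c S1 S2 \<in> G \<longrightarrow> RightRule c S3 \<in> G \<longrightarrow>
        \<not> (\<exists>u. \<forall>cl \<in> S1 \<union> S2 \<union> S3. satisfies u cl))"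

section \<open>Decidability\<close>

text \<open>
  The (total) general recursive functions of \<open>n\<close> arguments, the arguments being passed as a
  list of length \<open>n\<close>: the least class containing zero, successor and projections and closed
  under composition, primitive recursion and minimisation of regular functions.  Only the
  values on lists of length \<open>n\<close> are significant.
\<close>

inductive recursive :: "nat \<Rightarrow> (nat list \<Rightarrow> nat) \<Rightarrow> bool" where
  zero: "recursive n (\<lambda>xs. 0)"
| suc: "recursive 1 (\<lambda>xs. Suc (xs ! 0))"
| proj: "i < n \<Longrightarrow> recursive n (\<lambda>xs. xs ! i)"
| comp: "recursive (length gs) f \<Longrightarrow> (\<And>g. g \<in> set gs \<Longrightarrow> recursive n g) \<Longrightarrow>
    recursive n (\<lambda>xs. f (map (\<lambda>g. g xs) gs))"
| prim: "recursive n f \<Longrightarrow> recursive (Suc (Suc n)) g \<Longrightarrow>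
    recursive (Suc n) (\<lambda>xs. rec_nat (f (tl xs)) (\<lambda>k r. g (k # r # tl xs)) (hd xs))"
| mu: "recursive (Suc n) f \<Longrightarrow> (\<And>xs. length xs = n \<Longrightarrow> \<exists>k. f (k # xs) = 0) \<Longrightarrow>
    recursive n (\<lambda>xs. LEAST k. f (k # xs) = 0)"

text \<open>The property \<open>P\<close> of objects from \<open>D\<close>, presented to the algorithm by their codes, is
  decidable.\<close>

definition decidable_on :: "('a \<Rightarrow> nat) \<Rightarrow> 'a set \<Rightarrow> ('a \<Rightarrow> bool) \<Rightarrow> bool" where
  "decidable_on code D P \<longleftrightarrow> (\<exists>f. recursive 1 f \<and> (\<forall>x \<in> D. f [code x] = of_bool (P x)))"

text \<open>All codes below are injective on the finite objects they are applied to; see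
  \<open>inj_fm_code\<close>, \<open>inj_on_seq_code\<close>, \<open>inj_on_rule_code\<close> and \<open>inj_on_problem_code\<close>.\<close>

primrec fm_code :: "fm \<Rightarrow> nat" where
  "fm_code (Atom i) = prod_encode (0, i)"
| "fm_code (Con c \<phi>s) = prod_encode (Suc c, list_encode (map fm_code \<phi>s))"

fun seq_code :: "seq \<Rightarrow> nat" where
  "seq_code (\<Gamma>, E) = prod_encode (set_encode (fm_code ` \<Gamma>),
     case E of None \<Rightarrow> 0 | Some \<phi> \<Rightarrow> Suc (fm_code \<phi>))"

definition seqs_code :: "seq set \<Rightarrow> nat" where
  "seqs_code S = set_encode (seq_code ` S)"

fun rule_code :: "rule \<Rightarrow> nat" where
  "rule_code (RightRule c S) = prod_encode (0, prod_encode (c, seqs_code S))"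
| "rule_code (LeftRule c S1 S2) =
     prod_encode (1, prod_encode (c, prod_encode (seqs_code S1, seqs_code S2)))"

fun problem_code :: "seq set \<times> seq \<Rightarrow> nat" where
  "problem_code (S, s) = prod_encode (seqs_code S, seq_code s)"

definition strongly_decidable :: "language \<Rightarrow> system \<Rightarrow> bool" where
  "strongly_decidable L G \<longleftrightarrow>
     decidable_on problem_code ({S. finite S \<and> S \<subseteq> sequents L} \<times> sequents L)
       (\<lambda>(S, s). derivable L G S s)"

text \<open>
  It is decidable which canonical rules belong to \<open>G\<close>.  Some such condition is unavoidable when
  there are infinitely many connectives: for nullary connectives \<open>c\<^sub>k\<close> and a nonrecursive set
  \<open>K\<close>, the rules \<open>/ \<Rightarrow> c\<^sub>k\<close> with \<open>k \<in> K\<close> form a coherent but undecidable system.  Over a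
  language with finitely many connectives the condition always holds, and so it does for
  finite \<open>G\<close>; see \<open>effective_if_finite_language\<close> and \<open>effective_if_finite\<close>.
\<close>

definition effective :: "language \<Rightarrow> system \<Rightarrow> bool" where
  "effective L G \<longleftrightarrow> decidable_on rule_code {r. canonical_rule L r} (\<lambda>r. r \<in> G)"

section \<open>Injectivity of the codes\<close>

lemma fm_code_inject: "fm_code \<phi> = fm_code \<psi> \<Longrightarrow> \<phi> = \<psi>"
proof (induction \<phi> arbitrary: \<psi>)
  case (Atom i)
  then show ?case by (cases \<psi>) auto
next
  case (Con c \<phi>s)
  then obtain \<psi>s where \<psi>: "\<psi> = Con c \<psi>s" "map fm_code \<phi>s = map fm_code \<psi>s"
    using injD[OF inj_list_encode] by (cases \<psi>) auto
  then have "\<phi>s = \<psi>s"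
    using Con.IH by (auto simp: list_eq_iff_nth_eq map_equality_iff)
  then show ?case using \<psi> by simp
qed

lemma inj_fm_code: "inj fm_code"
  by (rule injI) (rule fm_code_inject)

lemma inj_on_seq_code: "inj_on seq_code {(\<Gamma>, E). finite \<Gamma>}"
proof (rule inj_onI, clarify)
  fix \<Gamma> \<Gamma>' E E'
  assume fin: "finite \<Gamma>" "finite \<Gamma>'" and eq: "seq_code (\<Gamma>, E) = seq_code (\<Gamma>', E')"
  from eq have "fm_code ` \<Gamma> = fm_code ` \<Gamma>'"
    using fin by (simp add: set_encode_eq)
  moreover from eq have "E = E'"
    by (auto split: option.splits dest: fm_code_inject)
  ultimately show "\<Gamma> = \<Gamma>' \<and> E = E'"
    using inj_fm_code by (simp add: inj_image_eq_iff)
qed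

lemma inj_on_seqs_code: "inj_on seqs_code {S. finite S \<and> S \<subseteq> {(\<Gamma>, E). finite \<Gamma>}}"
proof (rule inj_onI)
  fix S S' :: "seq set"
  assume "S \<in> {S. finite S \<and> S \<subseteq> {(\<Gamma>, E). finite \<Gamma>}}"
    and "S' \<in> {S. finite S \<and> S \<subseteq> {(\<Gamma>, E). finite \<Gamma>}}" and "seqs_code S = seqs_code S'"
  then show "S = S'"
    using inj_on_image_eq_iff[OF inj_on_seq_code] by (simp add: seqs_code_def set_encode_eq)
qed

lemma clauses_finite: "S \<subseteq> clauses n \<Longrightarrow> S \<subseteq> {(\<Gamma>, E). finite \<Gamma>}"
proof
  fix s assume "S \<subseteq> clauses n" "s \<in> S"
  then have "s \<in> clauses n" by blast
  then have "fst s \<subseteq> Atom ` {..<n}"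
    by (cases s) (simp add: clauses_def)
  then have "finite (fst s)"
    by (rule finite_subset) simp
  then show "s \<in> {(\<Gamma>, E). finite \<Gamma>}"
    by (simp add: case_prod_beta)
qed

lemma inj_on_rule_code: "inj_on rule_code {r. canonical_rule L r}"
proof (rule inj_onI)
  fix r r'
  assume r: "r \<in> {r. canonical_rule L r}" "r' \<in> {r. canonical_rule L r}"
    and eq: "rule_code r = rule_code r'"
  have inj: "S = S'"
    if "seqs_code S = seqs_code S'" "finite S" "finite S'" "S \<subseteq> clauses n" "S' \<subseteq> clauses n'"
    for S S' n n'
    using that inj_on_seqs_code[THEN inj_onD, of S S'] clauses_finite by simp
  show "r = r'"
  proof (cases r; cases r')
    fix c S c' S' assume *: "r = RightRule c S" "r' = RightRule c' S'"
    then show ?thesis using r eq inj[of S S'] by auto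
  next
    fix c S1 S2 c' S1' S2' assume *: "r = LeftRule c S1 S2" "r' = LeftRule c' S1' S2'"
    then obtain n n' where "finite S1" "S1 \<subseteq> clauses n" "finite S2" "S2 \<subseteq> clauses n"
      "finite S1'" "S1' \<subseteq> clauses n'" "finite S2'" "S2' \<subseteq> clauses n'"
      using r by auto
    moreover have "c = c'" "seqs_code S1 = seqs_code S1'" "seqs_code S2 = seqs_code S2'"
      using eq * by simp_all
    ultimately show ?thesis
      using inj[of S1 S1' n n'] inj[of S2 S2' n n'] * by simp
  qed (use eq in simp_all)
qed

lemma inj_on_problem_code:
  "inj_on problem_code ({S. finite S \<and> S \<subseteq> sequents L} \<times> sequents L)"
proof -
  have sub: "sequents L \<subseteq> {(\<Gamma>, E). finite \<Gamma>}"
    by (auto simp: sequents_def)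
  show ?thesis
  proof (rule inj_onI)
    fix x x'
    assume "x \<in> {S. finite S \<and> S \<subseteq> sequents L} \<times> sequents L"
      and "x' \<in> {S. finite S \<and> S \<subseteq> sequents L} \<times> sequents L"
      and eq: "problem_code x = problem_code x'"
    then obtain S s S' s' where x: "x = (S, s)" "x' = (S', s')"
      and *: "finite S" "S \<subseteq> sequents L" "finite S'" "S' \<subseteq> sequents L"
        "s \<in> sequents L" "s' \<in> sequents L"
      by blast
    have "seqs_code S = seqs_code S'" "seq_code s = seq_code s'"
      using eq by (simp_all add: x)
    then have "S = S'" "s = s'"
      using * sub inj_on_seqs_code[THEN inj_onD, of S S']
        inj_on_seq_code[THEN inj_onD, of s s']
      by blast+
    then show "x = x'" by (simp add: x)
  qed
qed

section \<open>Finite systems are effective\<close>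

lemma recursive_finite_support:
  "(\<And>x. x \<ge> N \<Longrightarrow> g x = 0) \<Longrightarrow> \<exists>f. recursive 1 f \<and> (\<forall>x. f [x] = g x)"
proof (induction N arbitrary: g)
  case 0
  then show ?case using recursive.zero[of 1] by auto
next
  case (Suc N)
  have "\<exists>f. recursive 1 f \<and> (\<forall>x. f [x] = g (Suc x))"
    by (rule Suc.IH) (simp add: Suc.prems)
  then obtain f where f: "recursive 1 f" "\<And>x. f [x] = g (Suc x)"
    by auto
  have const: "\<exists>h. recursive 0 h \<and> h [] = k" for k
  proof (induction k)
    case 0
    then show ?case using recursive.zero[of 0] by auto
  next
    case (Suc k)
    then obtain h where "recursive 0 h" "h [] = k" by auto
    then show ?case
      using recursive.comp[of "[h]" "\<lambda>xs. Suc (xs ! 0)" 0] recursive.suc by fastforce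
  qed
  obtain h where h: "recursive 0 h" "h [] = g 0"
    using const by auto
  have "recursive 2 (\<lambda>xs. f [xs ! 0])"
    using recursive.comp[of "[\<lambda>xs. xs ! 0]" f 2] recursive.proj[of 0 2] f(1) by simp
  then have "recursive (Suc (Suc 0)) (\<lambda>xs. f [xs ! 0])"
    by (simp add: numeral_2_eq_2)
  from recursive.prim[OF h(1) this]
  have "recursive 1 (\<lambda>xs. rec_nat (h (tl xs)) (\<lambda>k r. f [(k # r # tl xs) ! 0]) (hd xs))"
    by simp
  moreover have "rec_nat (h []) (\<lambda>k r. f [([k, r]) ! 0]) x = g x" for x
    by (cases x) (simp_all add: h f(2))
  ultimately show ?case
    by (intro exI[of _ "\<lambda>xs. rec_nat (h (tl xs)) (\<lambda>k r. f [(k # r # tl xs) ! 0]) (hd xs)"])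
      simp
qed

lemma effective_if_finite:
  assumes "canonical_system L G" "finite G"
  shows "effective L G"
proof -
  define g where "g x = (of_bool (x \<in> rule_code ` G) :: nat)" for x
  obtain N where "\<forall>x \<in> rule_code ` G. x < N"
    using finite_nat_set_iff_bounded[of "rule_code ` G"] assms(2) by auto
  then have "\<And>x. x \<ge> N \<Longrightarrow> g x = 0"
    by (force simp: g_def)
  then obtain f where f: "recursive 1 f" "\<And>x. f [x] = g x"
    using recursive_finite_support[of N g] by blast
  have "f [rule_code r] = of_bool (r \<in> G)" if "canonical_rule L r" for r
    unfolding f(2) g_def
    using that assms(1) inj_onD[OF inj_on_rule_code[of L]]
    by (auto simp: canonical_system_def)
  then show ?thesis
    using f(1) by (auto simp: effective_def decidable_on_def)
qed

lemma effective_if_finite_language: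
  assumes "canonical_system L G" "finite (dom L)"
  shows "effective L G"
proof (rule effective_if_finite[OF assms(1)])
  have fin: "finite (Pow (clauses n))" for n
  proof -
    have "clauses n \<subseteq> Pow (Atom ` {..<n}) \<times> insert None (Some ` Atom ` {..<n})"
    proof
      fix s assume "s \<in> clauses n"
      then show "s \<in> Pow (Atom ` {..<n}) \<times> insert None (Some ` Atom ` {..<n})"
        by (cases s; cases "snd s") (auto simp: clauses_def)
    qed
    then have "finite (clauses n)" by (rule finite_subset) simp
    then show ?thesis by simp
  qed
  let ?B = "\<Union>c \<in> dom L. Pow (clauses (the (L c)))"
  have "G \<subseteq> case_prod RightRule ` (dom L \<times> ?B) \<union>
      (\<lambda>(c, S1, S2). LeftRule c S1 S2) ` (dom L \<times> ?B \<times> ?B)"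
  proof
    fix r assume "r \<in> G"
    then have "canonical_rule L r"
      using assms(1) by (auto simp: canonical_system_def)
    then show "r \<in> case_prod RightRule ` (dom L \<times> ?B) \<union>
        (\<lambda>(c, S1, S2). LeftRule c S1 S2) ` (dom L \<times> ?B \<times> ?B)"
    proof (cases r)
      case (RightRule c S)
      then have "c \<in> dom L" "S \<in> ?B" using \<open>canonical_rule L r\<close> by (auto intro!: bexI[of _ c])
      then show ?thesis unfolding RightRule by (intro UnI1 rev_image_eqI[of "(c, S)"]) auto
    next
      case (LeftRule c S1 S2)
      then have "c \<in> dom L" "S1 \<in> ?B" "S2 \<in> ?B"
        using \<open>canonical_rule L r\<close> by (auto intro!: bexI[of _ c])
      then show ?thesis unfolding LeftRule by (intro UnI2 rev_image_eqI[of "(c, S1, S2)"]) auto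
    qed
  qed
  moreover have "finite \<dots>"
    using assms(2) fin by auto
  ultimately show "finite G"
    by (rule finite_subset)
qed

end

theory Submission
  imports Defs
begin

text \<open>
  Derivability has the finite countermodel property.  Fix a finite set \<open>F\<close> of formulas that
  contains the given sequents and is closed under subformulas.  If \<open>s\<close> is not derivable from \<open>\<S>\<close>,
  then the subsets \<open>w\<close> of \<open>F\<close> that are maximal with \<open>w \<Rightarrow> E\<close> not derivable, for some \<open>E\<close> over
  \<open>F\<close>, form a Kripke model ordered by inclusion: it validates \<open>\<S>\<close>, refutes \<open>s\<close> and respects all
  instances of the rules of \<open>G\<close> whose principal formula is in \<open>F\<close>.  Conversely, coherence allows
  one to extend the valuation of any such model to all formulas so that all rules are respected,
  hence \<open>s\<close> is not derivable.  So cut elimination is not needed, and \<open>s\<close> is derivable iff no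
  countermodel exists among the finitely many families of subsets of \<open>F\<close>.  This search is a
  bounded quantification over codes.  As \<open>L\<close> itself need not be decidable, the search also ranges
  over sets \<open>F\<close> with ill-formed members; these merely put more constraints on a countermodel.
\<close>

section \<open>Recursive functions\<close>

text \<open>Only the values on lists of length \<open>n\<close> matter.  In the closure rules for binding operators the
  bound variable becomes the new head of the argument list.\<close>

definition computable :: "nat \<Rightarrow> (nat list \<Rightarrow> nat) \<Rightarrow> bool" where
  "computable n f \<longleftrightarrow> (\<exists>g. recursive n g \<and> (\<forall>xs. length xs = n \<longrightarrow> g xs = f xs))"

abbreviation computable_pred :: "nat \<Rightarrow> (nat list \<Rightarrow> bool) \<Rightarrow> bool" where
  "computable_pred n P \<equiv> computable n (\<lambda>xs. of_bool (P xs))"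

lemma computable_cong:
  assumes "computable n f" "\<And>xs. length xs = n \<Longrightarrow> f xs = g xs"
  shows "computable n g"
  using assms unfolding computable_def by metis

lemma computable_recursive: "recursive n f \<Longrightarrow> computable n f"
  unfolding computable_def by blast

lemma computable_compose:
  assumes f: "computable (length gs) f" and gs: "\<And>g. g \<in> set gs \<Longrightarrow> computable n g"
  shows "computable n (\<lambda>xs. f (map (\<lambda>g. g xs) gs))"
proof -
  obtain f' where f': "recursive (length gs) f'" "\<And>xs. length xs = length gs \<Longrightarrow> f' xs = f xs"
    using f unfolding computable_def by blast
  obtain h where h: "\<And>g. g \<in> set gs \<Longrightarrow>
      recursive n (h g) \<and> (\<forall>xs. length xs = n \<longrightarrow> h g xs = g xs)"
    using gs unfolding computable_def by metis
  have "recursive n (\<lambda>xs. f' (map (\<lambda>g. g xs) (map h gs)))"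
    using f'(1) h by (intro recursive.comp) auto
  moreover have "map (\<lambda>g. g xs) (map h gs) = map (\<lambda>g. g xs) gs" if "length xs = n" for xs
    using h that by auto
  ultimately show ?thesis
    unfolding computable_def
    by (intro exI[of _ "\<lambda>xs. f' (map (\<lambda>g. g xs) (map h gs))"]) (simp del: map_map add: f'(2))
qed

lemma computable_compose1:
  "computable 1 (\<lambda>xs. h (xs ! 0)) \<Longrightarrow> computable n a \<Longrightarrow> computable n (\<lambda>xs. h (a xs))"
  using computable_compose[of "[a]" "\<lambda>xs. h (xs ! 0)" n] by simp

lemma computable_compose2:
  "computable 2 (\<lambda>xs. h (xs ! 0) (xs ! 1)) \<Longrightarrow> computable n a \<Longrightarrow> computable n b \<Longrightarrow>
    computable n (\<lambda>xs. h (a xs) (b xs))"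
  using computable_compose[of "[a, b]" "\<lambda>xs. h (xs ! 0) (xs ! 1)" n]
  by (auto simp: numeral_2_eq_2)

lemma computable_compose3:
  "computable 3 (\<lambda>xs. h (xs ! 0) (xs ! 1) (xs ! 2)) \<Longrightarrow>
    computable n a \<Longrightarrow> computable n b \<Longrightarrow> computable n c \<Longrightarrow>
    computable n (\<lambda>xs. h (a xs) (b xs) (c xs))"
  using computable_compose[of "[a, b, c]" "\<lambda>xs. h (xs ! 0) (xs ! 1) (xs ! 2)" n]
  by (auto simp: numeral_3_eq_3)

lemma computable_compose4:
  "computable 4 (\<lambda>xs. h (xs ! 0) (xs ! 1) (xs ! 2) (xs ! 3)) \<Longrightarrow>
    computable n a \<Longrightarrow> computable n b \<Longrightarrow> computable n c \<Longrightarrow> computable n d \<Longrightarrow>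
    computable n (\<lambda>xs. h (a xs) (b xs) (c xs) (d xs))"
  using computable_compose[of "[a, b, c, d]" "\<lambda>xs. h (xs ! 0) (xs ! 1) (xs ! 2) (xs ! 3)" n]
  by (auto simp: numeral_eq_Suc)

lemma computable_nth: "i < n \<Longrightarrow> computable n (\<lambda>xs. xs ! i)"
  by (intro computable_recursive recursive.proj)

text \<open>Adds a dummy first argument, as when a term is moved under a binder. On lists of length
  \<open>Suc n\<close> the tail is the list of the projections other than the first, so this is an
  instance of composition.\<close>

lemma computable_tl: "computable n f \<Longrightarrow> computable (Suc n) (\<lambda>xs. f (tl xs))"
proof -
  assume f: "computable n f"
  let ?gs = "map (\<lambda>i xs. xs ! Suc i) [0..<n]"
  have "computable (Suc n) (\<lambda>xs. f (map (\<lambda>g. g xs) ?gs))"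
    by (rule computable_compose) (use f in \<open>auto intro: computable_nth\<close>)
  then show ?thesis
    by (rule computable_cong) (auto simp: nth_tl intro!: arg_cong[of _ _ f] nth_equalityI)
qed

lemma computable_Suc: "computable n f \<Longrightarrow> computable n (\<lambda>xs. Suc (f xs))"
  by (rule computable_compose1[OF computable_recursive[OF recursive.suc]])

lemma computable_const: "computable n (\<lambda>xs. k)"
  by (induction k) (rule computable_recursive[OF recursive.zero], rule computable_Suc)

text \<open>The constructor \<open>recursive.prim\<close> recurses on the head of the argument list.
  Here the number of iterations is an arbitrary term \<open>b\<close>: it is substituted for that
  head by composition, next to all \<open>n\<close> projections, which keep the parameters available
  to the step function.\<close>

lemma computable_rec_nat:
  assumes f: "computable n f"
    and g: "computable (Suc (Suc n)) (\<lambda>xs. g (xs ! 0) (xs ! 1) (tl (tl xs)))"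
    and b: "computable n b"
  shows "computable n (\<lambda>xs. rec_nat (f xs) (\<lambda>k r. g k r xs) (b xs))"
proof -
  obtain f' where f': "recursive n f'" "\<And>xs. length xs = n \<Longrightarrow> f' xs = f xs"
    using f unfolding computable_def by blast
  obtain g' where g': "recursive (Suc (Suc n)) g'"
    "\<And>xs. length xs = Suc (Suc n) \<Longrightarrow> g' xs = g (xs ! 0) (xs ! 1) (tl (tl xs))"
    using g unfolding computable_def by blast
  let ?h = "\<lambda>xs. rec_nat (f' (tl xs)) (\<lambda>k r. g' (k # r # tl xs)) (hd xs)"
  have "computable (Suc n) ?h"
    by (intro computable_recursive recursive.prim f' g')
  then have h: "computable (Suc n) (\<lambda>xs. rec_nat (f (tl xs)) (\<lambda>k r. g k r (tl xs)) (hd xs))"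
  proof (rule computable_cong)
    fix xs :: "nat list"
    assume xs: "length xs = Suc n"
    have "rec_nat (f' (tl xs)) (\<lambda>k r. g' (k # r # tl xs)) m =
        rec_nat (f (tl xs)) (\<lambda>k r. g k r (tl xs)) m" for m
      using xs f'(2) g'(2) by (induction m) auto
    then show "?h xs = rec_nat (f (tl xs)) (\<lambda>k r. g k r (tl xs)) (hd xs)" .
  qed
  let ?gs = "b # map (\<lambda>i xs. xs ! i) [0..<n]"
  have "computable n (\<lambda>xs. (\<lambda>xs. rec_nat (f (tl xs)) (\<lambda>k r. g k r (tl xs)) (hd xs))
      (map (\<lambda>g. g xs) ?gs))"
    by (rule computable_compose) (use h b in \<open>auto intro: computable_nth\<close>)
  then show ?thesis
  proof (rule computable_cong)
    fix xs :: "nat list"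
    assume "length xs = n"
    then have "map (\<lambda>g. g xs) (map (\<lambda>i xs. xs ! i) [0..<n]) = xs"
      by (auto intro: nth_equalityI)
    then show "(\<lambda>xs. rec_nat (f (tl xs)) (\<lambda>k r. g k r (tl xs)) (hd xs)) (map (\<lambda>g. g xs) ?gs) =
        rec_nat (f xs) (\<lambda>k r. g k r xs) (b xs)"
      by simp
  qed
qed

text \<open>Each binder puts one more \<open>tl\<close> on the variables outside it, so these are
  the shapes of a variable below at most six nested binders.\<close>

lemma computable_var:
  "i < n \<Longrightarrow> computable n (\<lambda>xs. xs ! i)"
  "i < n - 1 \<Longrightarrow> computable n (\<lambda>xs. tl xs ! i)"
  "i < n - 2 \<Longrightarrow> computable n (\<lambda>xs. tl (tl xs) ! i)"
  "i < n - 3 \<Longrightarrow> computable n (\<lambda>xs. tl (tl (tl xs)) ! i)"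
  "i < n - 4 \<Longrightarrow> computable n (\<lambda>xs. tl (tl (tl (tl xs))) ! i)"
  "i < n - 5 \<Longrightarrow> computable n (\<lambda>xs. tl (tl (tl (tl (tl xs)))) ! i)"
  "i < n - 6 \<Longrightarrow> computable n (\<lambda>xs. tl (tl (tl (tl (tl (tl xs))))) ! i)"
proof -
  have step: "(\<forall>n. i < n - m \<longrightarrow> computable n f) \<Longrightarrow>
      \<forall>n. i < n - Suc m \<longrightarrow> computable n (\<lambda>xs. f (tl xs))" for f m
  proof (intro allI impI)
    fix n assume *: "\<forall>n. i < n - m \<longrightarrow> computable n f" "i < n - Suc m"
    from *(2) have n: "Suc (n - 1) = n" and "i < (n - 1) - m" by linarith+
    then have "computable (n - 1) f" using *(1) by blast
    from computable_tl[OF this] show "computable n (\<lambda>xs. f (tl xs))"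
      unfolding n .
  qed
  have 0: "\<forall>n. i < n - 0 \<longrightarrow> computable n (\<lambda>xs. xs ! i)"
    by (simp add: computable_nth)
  note 1 = step[OF 0] note 2 = step[OF 1] note 3 = step[OF 2]
  note 4 = step[OF 3] note 5 = step[OF 4] note 6 = step[OF 5]
  show "i < n \<Longrightarrow> computable n (\<lambda>xs. xs ! i)"
    "i < n - 1 \<Longrightarrow> computable n (\<lambda>xs. tl xs ! i)"
    "i < n - 2 \<Longrightarrow> computable n (\<lambda>xs. tl (tl xs) ! i)"
    "i < n - 3 \<Longrightarrow> computable n (\<lambda>xs. tl (tl (tl xs)) ! i)"
    "i < n - 4 \<Longrightarrow> computable n (\<lambda>xs. tl (tl (tl (tl xs))) ! i)"
    "i < n - 5 \<Longrightarrow> computable n (\<lambda>xs. tl (tl (tl (tl (tl xs)))) ! i)"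
    "i < n - 6 \<Longrightarrow> computable n (\<lambda>xs. tl (tl (tl (tl (tl (tl xs))))) ! i)"
    using 0 1 2 3 4 5 6 by (simp_all add: numeral_eq_Suc)
qed

section \<open>Arithmetic, connectives, bounded quantifiers and minimisation\<close>

lemma computable_add:
  "computable n f \<Longrightarrow> computable n g \<Longrightarrow> computable n (\<lambda>xs. f xs + g xs)"
proof (rule computable_compose2[where h = "(+)"])
  have "computable 2 (\<lambda>xs. rec_nat (xs ! 0) (\<lambda>k r. Suc r) (xs ! 1))"
    \<comment> \<open>The closure rules follow the syntax of the term; \<open>simp\<close> is left
      with the bounds on variable indices. Later computability proofs have the same form.\<close>
    by (rule computable_rec_nat computable_Suc computable_var | simp)+
  moreover have "rec_nat a (\<lambda>k r. Suc r) b = a + b" for a b :: nat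
    by (induction b) auto
  ultimately show "computable 2 (\<lambda>xs. xs ! 0 + xs ! 1)" by simp
qed

lemma computable_mult:
  "computable n f \<Longrightarrow> computable n g \<Longrightarrow> computable n (\<lambda>xs. f xs * g xs)"
proof (rule computable_compose2[where h = "(*)"])
  have "computable 2 (\<lambda>xs. rec_nat 0 (\<lambda>k r. xs ! 0 + r) (xs ! 1))"
    by (rule computable_rec_nat computable_const computable_add computable_var | simp)+
  moreover have "rec_nat 0 (\<lambda>k r. a + r) b = a * b" for a b :: nat
    by (induction b) auto
  ultimately show "computable 2 (\<lambda>xs. xs ! 0 * xs ! 1)" by simp
qed

lemma computable_pow:
  "computable n f \<Longrightarrow> computable n (\<lambda>xs. 2 ^ f xs)"
proof (rule computable_compose1[where h = "\<lambda>a. 2 ^ a"])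
  have "computable 1 (\<lambda>xs. rec_nat 1 (\<lambda>k r. 2 * r) (xs ! 0))"
    by (rule computable_rec_nat computable_const computable_mult computable_var | simp)+
  moreover have "rec_nat 1 (\<lambda>k r. 2 * r) b = (2 :: nat) ^ b" for b :: nat
    by (induction b) auto
  ultimately show "computable 1 (\<lambda>xs. 2 ^ (xs ! 0))" by simp
qed

lemma computable_diff:
  "computable n f \<Longrightarrow> computable n g \<Longrightarrow> computable n (\<lambda>xs. f xs - g xs)"
proof (rule computable_compose2[where h = "(-)"])
  \<comment> \<open>Returning the counter instead of the previous value gives the predecessor, with
    0 sent to 0. Iterating it gives truncated subtraction.\<close>
  have "computable 1 (\<lambda>xs. rec_nat 0 (\<lambda>k r. k) (xs ! 0))"
    by (rule computable_rec_nat computable_const computable_var | simp)+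
  moreover have "rec_nat 0 (\<lambda>k r. k) b = b - 1" for b :: nat
    by (induction b) auto
  ultimately have pred: "computable 1 (\<lambda>xs. xs ! 0 - 1)" by simp
  have "computable 2 (\<lambda>xs. rec_nat (xs ! 0) (\<lambda>k r. r - 1) (xs ! 1))"
    by (rule computable_rec_nat computable_var computable_compose1[OF pred] | simp)+
  moreover have "rec_nat a (\<lambda>k r. r - 1) b = a - b" for a b :: nat
    by (induction b) auto
  ultimately show "computable 2 (\<lambda>xs. xs ! 0 - xs ! 1)" by simp
qed

lemma computable_not:
  assumes "computable_pred n P"
  shows "computable_pred n (\<lambda>xs. \<not> P xs)"
proof -
  have "(of_bool (\<not> P xs) :: nat) = 1 - of_bool (P xs)" for xs by simp
  then show ?thesis using assms by (simp only:) (intro computable_diff computable_const)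
qed

lemma computable_conj:
  "computable_pred n P \<Longrightarrow> computable_pred n Q \<Longrightarrow> computable_pred n (\<lambda>xs. P xs \<and> Q xs)"
  unfolding of_bool_conj by (rule computable_mult)

lemma computable_disj:
  "computable_pred n P \<Longrightarrow> computable_pred n Q \<Longrightarrow> computable_pred n (\<lambda>xs. P xs \<or> Q xs)"
  using computable_not[OF computable_conj[OF computable_not computable_not], of n P Q] by simp

lemma computable_imp:
  "computable_pred n P \<Longrightarrow> computable_pred n Q \<Longrightarrow> computable_pred n (\<lambda>xs. P xs \<longrightarrow> Q xs)"
  unfolding imp_conv_disj by (intro computable_disj computable_not)

lemma computable_le:
  assumes "computable n f" "computable n g"
  shows "computable_pred n (\<lambda>xs. f xs \<le> g xs)"
proof -
  have "(of_bool (f xs \<le> g xs) :: nat) = 1 - (f xs - g xs)" for xs by simp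
  then show ?thesis using assms by (simp only:) (intro computable_diff computable_const)
qed

lemma computable_less:
  "computable n f \<Longrightarrow> computable n g \<Longrightarrow> computable_pred n (\<lambda>xs. f xs < g xs)"
  unfolding linorder_not_le[symmetric] by (intro computable_not computable_le)

lemma computable_eq:
  "computable n f \<Longrightarrow> computable n g \<Longrightarrow> computable_pred n (\<lambda>xs. f xs = g xs)"
  unfolding order_eq_iff by (intro computable_conj computable_le)

text \<open>The truth value of a bounded universal statement is the product of the truth values of
  its instances, which is formed by primitive recursion.\<close>

lemma computable_all_less:
  assumes P: "computable_pred (Suc n) (\<lambda>xs. P (xs ! 0) (tl xs))" and b: "computable n b"
  shows "computable_pred n (\<lambda>xs. \<forall>i<b xs. P i xs)"
proof -
  have "rec_nat 1 (\<lambda>k r. r * of_bool (P k xs)) m = (of_bool (\<forall>i<m. P i xs) :: nat)" for m xs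
    by (induction m) (auto simp: less_Suc_eq)
  moreover have "computable n (\<lambda>xs. rec_nat 1 (\<lambda>k r. r * of_bool (P k xs)) (b xs))"
  proof (rule computable_rec_nat[OF computable_const computable_mult b])
    \<comment> \<open>The recursion step receives the counter, the running product and the
      parameters; these projections omit the product, on which \<open>P\<close> does not
      depend.\<close>
    let ?gs = "(\<lambda>xs. xs ! 0) # map (\<lambda>i xs. xs ! Suc (Suc i)) [0..<n]"
    have "computable (Suc (Suc n)) (\<lambda>xs. (\<lambda>xs. of_bool (P (xs ! 0) (tl xs))) (map (\<lambda>g. g xs) ?gs))"
      by (rule computable_compose) (use P in \<open>auto intro: computable_nth\<close>)
    then show "computable_pred (Suc (Suc n)) (\<lambda>xs. P (xs ! 0) (tl (tl xs)))"
    proof (rule computable_cong)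
      fix xs :: "nat list"
      assume "length xs = Suc (Suc n)"
      then have "map (\<lambda>g. g xs) (map (\<lambda>i xs. xs ! Suc (Suc i)) [0..<n]) = tl (tl xs)"
        by (auto intro!: nth_equalityI simp: nth_tl)
      then show "(\<lambda>xs. of_bool (P (xs ! 0) (tl xs))) (map (\<lambda>g. g xs) ?gs) =
          of_bool (P (xs ! 0) (tl (tl xs)))"
        by simp
    qed
  qed (auto intro: computable_nth)
  ultimately show ?thesis by simp
qed

lemma computable_ex_less:
  assumes "computable_pred (Suc n) (\<lambda>xs. P (xs ! 0) (tl xs))" "computable n b"
  shows "computable_pred n (\<lambda>xs. \<exists>i<b xs. P i xs)"
  using computable_not[OF computable_all_less[OF computable_not[OF assms(1)] assms(2)]] by simp

text \<open>Minimisation looks for a zero, hence the detour through the characteristic function of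
  the negation.\<close>

lemma computable_Least:
  assumes P: "computable_pred (Suc n) (\<lambda>xs. P (xs ! 0) (tl xs))" and ex: "\<And>xs. \<exists>k. P k xs"
  shows "computable n (\<lambda>xs. LEAST k. P k xs)"
proof -
  obtain g where g: "recursive (Suc n) g"
    "\<And>xs. length xs = Suc n \<Longrightarrow> g xs = of_bool (\<not> P (xs ! 0) (tl xs))"
    using computable_not[OF P] unfolding computable_def by blast
  have *: "g (k # xs) = 0 \<longleftrightarrow> P k xs" if "length xs = n" for k xs
    using that g(2) by simp
  have "recursive n (\<lambda>xs. LEAST k. g (k # xs) = 0)"
    using g(1) by (rule recursive.mu) (simp add: * ex)
  then show ?thesis
    by (rule computable_cong[OF computable_recursive]) (simp add: *)
qed

lemmas computable_basic = computable_const computable_var computable_Suc computable_add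
  computable_mult computable_pow computable_diff computable_not computable_conj computable_disj
  computable_imp computable_le computable_less computable_eq computable_all_less
  computable_ex_less

section \<open>Computing with codes of pairs, finite sets and lists\<close>

lemma computable_prod_encode:
  "computable n f \<Longrightarrow> computable n g \<Longrightarrow> computable n (\<lambda>xs. prod_encode (f xs, g xs))"
proof -
  have "computable 1 (\<lambda>xs. rec_nat 0 (\<lambda>k r. r + Suc k) (xs ! 0))"
    by (rule computable_rec_nat computable_basic | simp)+
  moreover have "rec_nat 0 (\<lambda>k r. r + Suc k) b = triangle b" for b
    by (induction b) auto
  ultimately have "computable 1 (\<lambda>xs. triangle (xs ! 0))" by simp
  then show "computable n f \<Longrightarrow> computable n g \<Longrightarrow> computable n (\<lambda>xs. prod_encode (f xs, g xs))"
    unfolding prod_encode_def prod.case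
    by (intro computable_add) (auto intro: computable_compose1 computable_add)
qed

text \<open>Pairing is inverted by search. The second component is at most the code, so it can be
  quantified boundedly; the first component is the only solution and therefore the least
  one.\<close>

lemma computable_fst_decode:
  assumes "computable n f"
  shows "computable n (\<lambda>xs. fst (prod_decode (f xs)))"
proof (rule computable_compose1[OF _ assms, where h = "\<lambda>z. fst (prod_decode z)"])
  have "(\<exists>b<Suc z. prod_encode (a, b) = z) \<longleftrightarrow> a = fst (prod_decode z)" for a z
    by (cases "prod_decode z")
      (metis fst_conv le_imp_less_Suc le_prod_encode_2 prod_decode_inverse prod_encode_inverse)
  then have "(LEAST a. \<exists>b<Suc z. prod_encode (a, b) = z) = fst (prod_decode z)"
    and ex: "\<exists>a. \<exists>b<Suc z. prod_encode (a, b) = z" for z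
    by (auto intro: Least_equality)
  moreover have "computable 1 (\<lambda>xs. LEAST a. \<exists>b<Suc (xs ! 0). prod_encode (a, b) = xs ! 0)"
    by (rule computable_Least[OF _ ex] computable_basic computable_prod_encode | simp)+
  ultimately show "computable 1 (\<lambda>xs. fst (prod_decode (xs ! 0)))" by simp
qed

lemma computable_snd_decode:
  assumes "computable n f"
  shows "computable n (\<lambda>xs. snd (prod_decode (f xs)))"
proof (rule computable_compose1[OF _ assms, where h = "\<lambda>z. snd (prod_decode z)"])
  have "(\<exists>a<Suc z. prod_encode (a, b) = z) \<longleftrightarrow> b = snd (prod_decode z)" for b z
    by (cases "prod_decode z")
      (metis snd_conv le_imp_less_Suc le_prod_encode_1 prod_decode_inverse prod_encode_inverse)
  then have "(LEAST b. \<exists>a<Suc z. prod_encode (a, b) = z) = snd (prod_decode z)"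
    and ex: "\<exists>b. \<exists>a<Suc z. prod_encode (a, b) = z" for z
    by (auto intro: Least_equality)
  moreover have "computable 1 (\<lambda>xs. LEAST b. \<exists>a<Suc (xs ! 0). prod_encode (a, b) = xs ! 0)"
    by (rule computable_Least[OF _ ex] computable_basic computable_prod_encode | simp)+
  ultimately show "computable 1 (\<lambda>xs. snd (prod_decode (xs ! 0)))" by simp
qed

text \<open>\<open>set_decode m\<close> consists of the positions of the ones in the binary
  expansion of \<open>m\<close>. Writing out the division by \<open>2 ^ a\<close> with an odd
  quotient expresses membership by bounded quantifiers alone.\<close>

lemma set_decode_iff: "a \<in> set_decode m \<longleftrightarrow> (\<exists>q<Suc m. \<exists>r<2 ^ a. m = (2 * q + 1) * 2 ^ a + r)"
proof
  assume "a \<in> set_decode m"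
  then have "odd (m div 2 ^ a)" by (simp add: set_decode_def)
  then obtain q where q: "m div 2 ^ a = 2 * q + 1" by (elim oddE)
  then have "q \<le> m" using div_le_dividend[of m "2 ^ a"] by linarith
  moreover have "m = (2 * q + 1) * 2 ^ a + m mod 2 ^ a"
    using q by (metis div_mult_mod_eq)
  ultimately show "\<exists>q<Suc m. \<exists>r<2 ^ a. m = (2 * q + 1) * 2 ^ a + r"
    by (metis le_imp_less_Suc mod_less_divisor zero_less_numeral zero_less_power)
next
  assume "\<exists>q<Suc m. \<exists>r<2 ^ a. m = (2 * q + 1) * 2 ^ a + r"
  then obtain q r where "r < 2 ^ a" "m = r + (2 * q + 1) * 2 ^ a" by (auto simp: add.commute)
  then have "m div 2 ^ a = 2 * q + 1" by (simp only: div_mult_self1) simp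
  then show "a \<in> set_decode m" by (simp add: set_decode_def)
qed

text \<open>A one at position \<open>a\<close> contributes \<open>2 ^ a\<close>, which exceeds
  \<open>a\<close>. This makes a quantifier over the members of a coded set a bounded one.\<close>

lemma set_decode_less: "a \<in> set_decode m \<Longrightarrow> a < m"
proof -
  assume "a \<in> set_decode m"
  then have "2 ^ a \<le> m"
    using subset_decode_imp_le[of "2 ^ a" m] set_decode_inverse
    by (metis set_decode_iff le_add1 le_trans mult_le_mono1 le_add2 mult_1)
  then show ?thesis using less_exp[of a] by linarith
qed

lemma computable_mem_decode:
  "computable n f \<Longrightarrow> computable n g \<Longrightarrow> computable_pred n (\<lambda>xs. f xs \<in> set_decode (g xs))"
proof (rule computable_compose2[where h = "\<lambda>a m. of_bool (a \<in> set_decode m)"])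
  show "computable_pred 2 (\<lambda>xs. xs ! 0 \<in> set_decode (xs ! 1))"
    unfolding set_decode_iff by (rule computable_basic | simp)+
qed

lemma computable_ball_decode:
  assumes "computable_pred (Suc n) (\<lambda>xs. P (xs ! 0) (tl xs))" "computable n f"
  shows "computable_pred n (\<lambda>xs. \<forall>a\<in>set_decode (f xs). P a xs)"
proof -
  have "(\<forall>a\<in>set_decode (f xs). P a xs) \<longleftrightarrow> (\<forall>a<f xs. a \<in> set_decode (f xs) \<longrightarrow> P a xs)" for xs
    using set_decode_less by blast
  then show ?thesis
    using assms
    by (simp only:)
      (intro computable_all_less computable_imp computable_mem_decode computable_tl; simp add: computable_var)
qed

lemma computable_bex_decode:
  assumes "computable_pred (Suc n) (\<lambda>xs. P (xs ! 0) (tl xs))" "computable n f"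
  shows "computable_pred n (\<lambda>xs. \<exists>a\<in>set_decode (f xs). P a xs)"
  using computable_not[OF computable_ball_decode[OF computable_not[OF assms(1)] assms(2)]] by simp

text \<open>A nonempty list is coded by the successor of the pair of its head and the code of its
  tail; one iteration undoes the successor and keeps the second component.\<close>

definition drop_code :: "nat \<Rightarrow> nat \<Rightarrow> nat" where
  "drop_code l i = rec_nat l (\<lambda>k r. snd (prod_decode (r - 1))) i"

definition nth_code :: "nat \<Rightarrow> nat \<Rightarrow> nat" where
  "nth_code l i = fst (prod_decode (drop_code l i - 1))"

lemma list_decode_tl: "list_decode (snd (prod_decode (l - 1))) = tl (list_decode l)"
proof (cases l)
  case 0
  \<comment> \<open>The empty list has code 0. Truncated subtraction leaves 0, whose second
    component is again 0, in accordance with \<open>tl [] = []\<close>.\<close>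
  have "prod_decode 0 = (0, 0)" using prod_encode_inverse[of "(0, 0)"] by (simp add: prod_encode_def)
  then show ?thesis using 0 by simp
next
  case (Suc m)
  then show ?thesis by (simp split: prod.split)
qed

lemma list_decode_drop_code: "list_decode (drop_code l i) = drop i (list_decode l)"
  by (induction i) (simp_all add: drop_code_def list_decode_tl drop_Suc tl_drop del: One_nat_def)

lemma nth_code: "i < length (list_decode l) \<Longrightarrow> nth_code l i = list_decode l ! i"
proof -
  assume i: "i < length (list_decode l)"
  then have "hd (list_decode (drop_code l i)) = list_decode l ! i"
    by (simp add: list_decode_drop_code hd_drop_conv_nth)
  moreover have "list_decode (drop_code l i) \<noteq> []" using i by (simp add: list_decode_drop_code)
  then obtain m where "drop_code l i = Suc m" by (cases "drop_code l i") auto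
  ultimately show ?thesis by (simp add: nth_code_def split: prod.splits)
qed

text \<open>Only the empty list has code 0, so dropping \<open>k\<close> elements gives 0 exactly
  from the length onwards. The length thus becomes a minimisation.\<close>

lemma length_list_decode: "length (list_decode l) = (LEAST k. drop_code l k = 0)"
proof -
  have "drop_code l k = 0 \<longleftrightarrow> list_decode (drop_code l k) = []" for k
    by (metis list_decode.simps(1) list_decode_eq)
  then have "drop_code l k = 0 \<longleftrightarrow> length (list_decode l) \<le> k" for k
    by (simp add: list_decode_drop_code)
  then show ?thesis by (auto intro: Least_equality[symmetric])
qed

lemma computable_drop_code:
  "computable n f \<Longrightarrow> computable n g \<Longrightarrow> computable n (\<lambda>xs. drop_code (f xs) (g xs))"
proof (rule computable_compose2[where h = "drop_code"])
  show "computable 2 (\<lambda>xs. drop_code (xs ! 0) (xs ! 1))"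
    unfolding drop_code_def
    by (rule computable_rec_nat computable_basic computable_snd_decode | simp del: One_nat_def)+
qed

lemma computable_nth_code:
  "computable n f \<Longrightarrow> computable n g \<Longrightarrow> computable n (\<lambda>xs. nth_code (f xs) (g xs))"
  unfolding nth_code_def
  by (intro computable_fst_decode computable_diff computable_drop_code computable_const)

lemma computable_length_decode:
  "computable n f \<Longrightarrow> computable n (\<lambda>xs. length (list_decode (f xs)))"
proof (rule computable_compose1[where h = "\<lambda>l. length (list_decode l)"])
  have "\<exists>k. drop_code l k = 0" for l
    by (metis drop_all le_refl list_decode.simps(1) list_decode_drop_code list_decode_eq)
  then show "computable 1 (\<lambda>xs. length (list_decode (xs ! 0)))"
    unfolding length_list_decode
    by (rule_tac computable_Least) (rule computable_basic computable_drop_code | simp)+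
qed

lemmas computable_intros = computable_basic computable_prod_encode computable_fst_decode
  computable_snd_decode computable_mem_decode computable_ball_decode computable_bex_decode
  computable_nth_code computable_length_decode

section \<open>Countermodels\<close>

definition closed_under_subformulas :: "fm set \<Rightarrow> bool" where
  "closed_under_subformulas F \<longleftrightarrow> (\<forall>c \<psi>s. Con c \<psi>s \<in> F \<longrightarrow> set \<psi>s \<subseteq> F)"

definition seq_over :: "fm set \<Rightarrow> seq \<Rightarrow> bool" where
  "seq_over F s \<longleftrightarrow> fst s \<subseteq> F \<and> set_option (snd s) \<subseteq> F"

definition holds :: "fm set \<Rightarrow> seq \<Rightarrow> bool" where
  "holds w s \<longleftrightarrow> (\<exists>\<phi>\<in>fst s. \<phi> \<notin> w) \<or> (\<exists>\<phi>\<in>set_option (snd s). \<phi> \<in> w)"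

text \<open>Atom \<open>i\<close> of a clause stands for \<open>\<psi>s ! i\<close>. A clause is
  read as an intuitionistic entailment, hence the quantification over all larger worlds.\<close>

definition forces :: "fm set set \<Rightarrow> fm set \<Rightarrow> fm list \<Rightarrow> seq set \<Rightarrow> bool" where
  "forces W w \<psi>s S \<longleftrightarrow>
     (\<forall>cl\<in>S. \<forall>w'\<in>W. w \<subseteq> w' \<longrightarrow> satisfies (\<lambda>i. \<psi>s ! i \<in> w') cl)"

text \<open>The premises in \<open>S1\<close> have right-hand sides of their own and are tested at
  all larger worlds. Those in \<open>S2\<close> share the right-hand side of the conclusion, so they
  are tested at \<open>w\<close> alone.\<close>

definition respects_rules :: "system \<Rightarrow> fm set set \<Rightarrow> fm set \<Rightarrow> bool" where
  "respects_rules G W F \<longleftrightarrow>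
     (\<forall>w\<in>W. \<forall>c \<psi>s. Con c \<psi>s \<in> F \<longrightarrow>
        (\<forall>S. RightRule c S \<in> G \<longrightarrow> forces W w \<psi>s S \<longrightarrow> Con c \<psi>s \<in> w) \<and>
        (\<forall>S1 S2. LeftRule c S1 S2 \<in> G \<longrightarrow> forces W w \<psi>s S1 \<longrightarrow>
           (\<forall>cl\<in>S2. satisfies (\<lambda>i. \<psi>s ! i \<in> w) cl) \<longrightarrow> Con c \<psi>s \<notin> w))"

definition countermodel :: "system \<Rightarrow> seq set \<Rightarrow> seq \<Rightarrow> fm set set \<Rightarrow> fm set \<Rightarrow> bool" where
  "countermodel G \<S> s W F \<longleftrightarrow>
     respects_rules G W F \<and> (\<forall>w\<in>W. \<forall>q\<in>\<S>. holds w q) \<and> (\<exists>w\<in>W. \<not> holds w s)"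

text \<open>Valuations are given by \<open>nth\<close> on a list of length \<open>n\<close>, whose
  values beyond the list are unspecified; clauses of arity \<open>n\<close> cannot see
  these.\<close>

lemma satisfies_cong:
  assumes "cl \<in> clauses n" "\<And>i. i < n \<Longrightarrow> u i = v i"
  shows "satisfies u cl = satisfies v cl"
proof -
  obtain \<Pi> E where cl: "cl = (\<Pi>, E)" by (cases cl)
  have "\<And>i. Atom i \<in> \<Pi> \<Longrightarrow> i < n" "\<And>i. E = Some (Atom i) \<Longrightarrow> i < n"
    using assms(1) unfolding cl clauses_def by auto
  then show ?thesis
    using assms(2) unfolding cl satisfies_def by auto
qed

lemma canonical_clauses:
  assumes "canonical_system L G" "L c = Some n"
  shows "RightRule c S \<in> G \<Longrightarrow> S \<subseteq> clauses n"
    and "LeftRule c S1 S2 \<in> G \<Longrightarrow> S1 \<subseteq> clauses n"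
    and "LeftRule c S1 S2 \<in> G \<Longrightarrow> S2 \<subseteq> clauses n"
    and "LeftRule c S1 S2 \<in> G \<Longrightarrow> (\<Sigma>, E) \<in> S2 \<Longrightarrow> E = None"
  using assms unfolding canonical_system_def by fastforce+

lemma formulas_Con: "Con c \<phi>s \<in> formulas L \<longleftrightarrow> L c = Some (length \<phi>s) \<and> set \<phi>s \<subseteq> formulas L"
  by (subst formulas.simps) auto

text \<open>\<open>is_subst\<close> only characterises substitutions. This provides the concrete
  ones by which rules are instantiated in the construction of countermodels.\<close>

primrec subst_atoms :: "(nat \<Rightarrow> fm) \<Rightarrow> fm \<Rightarrow> fm" where
  "subst_atoms \<theta> (Atom i) = \<theta> i"
| "subst_atoms \<theta> (Con c \<phi>s) = Con c (map (subst_atoms \<theta>) \<phi>s)"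

lemma is_subst_subst_atoms:
  assumes "\<And>i. \<theta> i \<in> formulas L"
  shows "is_subst L (subst_atoms \<theta>)"
proof -
  have "subst_atoms \<theta> \<phi> \<in> formulas L" if "\<phi> \<in> formulas L" for \<phi>
    using that by induction (auto simp: assms formulas_Con)
  then show ?thesis by (simp add: is_subst_def)
qed

lemma is_subst_Con:
  assumes "is_subst L \<sigma>" "L c = Some n"
  shows "\<sigma> (Con c (map Atom [0..<n])) = Con c (map (\<sigma> \<circ> Atom) [0..<n])"
proof -
  have "Con c (map Atom [0..<n]) \<in> formulas L"
    using assms(2) by (auto simp: formulas_Con formulas.Atom)
  then show ?thesis
    using assms(1) by (simp add: is_subst_def)
qed

section \<open>Extending valuations to all formulas; soundness\<close>

context
  fixes L :: language and G :: system
  assumes canonical: "canonical_system L G"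
begin

text \<open>Formulas outside \<open>F\<close> are made true only where some right rule demands it.  Coherence then
  gives the left rules.\<close>

primrec ext :: "fm set set \<Rightarrow> fm set \<Rightarrow> fm \<Rightarrow> fm set set" where
  "ext W F (Atom i) = {w \<in> W. Atom i \<in> w}"
| "ext W F (Con c \<psi>s) =
    {w \<in> W. if Con c \<psi>s \<in> F then Con c \<psi>s \<in> w
      else \<exists>S. RightRule c S \<in> G \<and> (\<forall>cl\<in>S. \<forall>w'\<in>W. w \<subseteq> w' \<longrightarrow>
        satisfies (\<lambda>i. w' \<in> map (ext W F) \<psi>s ! i) cl)}"

lemma ext_mem: "\<phi> \<in> F \<Longrightarrow> ext W F \<phi> = {w \<in> W. \<phi> \<in> w}"
  by (cases \<phi>) auto

text \<open>Persistence of truth, by cases. For atoms and members of \<open>F\<close>, truth is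
  membership in the world. For other formulas the defining condition already quantifies over all
  larger worlds, so transitivity of inclusion gives the claim.\<close>

lemma ext_mono:
  assumes "w \<in> ext W F \<phi>" "w \<subseteq> w'" "w' \<in> W"
  shows "w' \<in> ext W F \<phi>"
proof (cases \<phi>)
  case (Atom i)
  then show ?thesis using assms by auto
next
  case (Con c \<psi>s)
  show ?thesis
  proof (cases "\<phi> \<in> F")
    case True
    then show ?thesis using assms by (auto simp: ext_mem)
  next
    case False
    have "w' \<subseteq> w'' \<Longrightarrow> w \<subseteq> w''" for w'' using assms(2) by (rule subset_trans)
    then show ?thesis
      using assms False unfolding Con ext.simps mem_Collect_eq if_not_P[OF False[unfolded Con]]
      by meson
  qed
qed

definition "truths W F w = {\<phi>. w \<in> ext W F \<phi>}"

definition forces_ext where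
  "forces_ext W F w \<psi>s S \<longleftrightarrow>
     (\<forall>cl\<in>S. \<forall>w'\<in>W. w \<subseteq> w' \<longrightarrow> satisfies (\<lambda>i. \<psi>s ! i \<in> truths W F w') cl)"

text \<open>Primitive recursion through lists leaves \<open>map (ext W F) \<psi>s ! i\<close> in the
  equation for \<open>ext\<close>. The arity assumption keeps the index of every atom that a rule
  for \<open>c\<close> mentions inside the list, where this is the truth of
  \<open>\<psi>s ! i\<close>.\<close>

lemma ext_Con:
  assumes "L c = Some (length \<psi>s)" "Con c \<psi>s \<notin> F"
  shows "w \<in> ext W F (Con c \<psi>s) \<longleftrightarrow>
    w \<in> W \<and> (\<exists>S. RightRule c S \<in> G \<and> forces_ext W F w \<psi>s S)"
proof -
  have "satisfies (\<lambda>i. w' \<in> map (ext W F) \<psi>s ! i) cl =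
      satisfies (\<lambda>i. \<psi>s ! i \<in> truths W F w') cl"
    if "RightRule c S \<in> G" "cl \<in> S" for w' S cl
    using that canonical_clauses(1)[OF canonical assms(1)]
    by (intro satisfies_cong) (auto simp: truths_def)
  then have "(\<forall>cl\<in>S. \<forall>w'\<in>W. w \<subseteq> w' \<longrightarrow> satisfies (\<lambda>i. w' \<in> map (ext W F) \<psi>s ! i) cl) \<longleftrightarrow>
      forces_ext W F w \<psi>s S" if "RightRule c S \<in> G" for S
    using that unfolding forces_ext_def by blast
  then show ?thesis
    using assms(2) unfolding ext.simps if_not_P[OF assms(2)] by blast
qed

lemma forces_ext_iff:
  assumes "S \<subseteq> clauses (length \<psi>s)" "set \<psi>s \<subseteq> F"
  shows "forces_ext W F w \<psi>s S \<longleftrightarrow> forces W w \<psi>s S"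
proof -
  have "satisfies (\<lambda>i. \<psi>s ! i \<in> truths W F w') cl = satisfies (\<lambda>i. \<psi>s ! i \<in> w') cl"
    if "cl \<in> S" "w' \<in> W" for cl w'
    using that assms nth_mem
    by (intro satisfies_cong[of _ "length \<psi>s"]) (blast, auto simp: truths_def ext_mem subset_iff)
  then show ?thesis by (auto simp: forces_ext_def forces_def)
qed

text \<open>In \<open>F\<close> this is inherited from \<open>respects_rules\<close>, since the
  immediate subformulas are in \<open>F\<close> too and have their given values; outside
  \<open>F\<close> it holds by the construction of \<open>ext\<close>.\<close>

lemma ext_right_rule:
  assumes "respects_rules G W F" "closed_under_subformulas F" "L c = Some (length \<psi>s)"
    "RightRule c S \<in> G" "w \<in> W" "forces_ext W F w \<psi>s S"
  shows "w \<in> ext W F (Con c \<psi>s)"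
proof (cases "Con c \<psi>s \<in> F")
  case True
  then have "set \<psi>s \<subseteq> F" using assms(2) by (auto simp: closed_under_subformulas_def)
  then have "forces W w \<psi>s S"
    using assms forces_ext_iff canonical_clauses(1)[OF canonical assms(3,4)] by blast
  then show ?thesis using assms True by (auto simp: respects_rules_def)
next
  case False
  then show ?thesis using assms by (auto simp: ext_Con simp del: ext.simps)
qed

text \<open>Outside \<open>F\<close>, a compound formula is true only because a right rule has
  forced premises. Together with the premises of the left rule this contradicts coherence.\<close>

lemma ext_left_rule:
  assumes "respects_rules G W F" "closed_under_subformulas F" "coherent G"
    "L c = Some (length \<psi>s)" "LeftRule c S1 S2 \<in> G" "w \<in> W" "forces_ext W F w \<psi>s S1"
    "\<forall>cl\<in>S2. satisfies (\<lambda>i. \<psi>s ! i \<in> truths W F w) cl"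
  shows "w \<notin> ext W F (Con c \<psi>s)"
proof (cases "Con c \<psi>s \<in> F")
  case True
  then have F: "set \<psi>s \<subseteq> F" using assms(2) by (auto simp: closed_under_subformulas_def)
  then have "forces W w \<psi>s S1"
    using assms forces_ext_iff canonical_clauses(2)[OF canonical assms(4,5)] by blast
  moreover have "satisfies (\<lambda>i. \<psi>s ! i \<in> w) cl" if "cl \<in> S2" for cl
  proof -
    have "satisfies (\<lambda>i. \<psi>s ! i \<in> truths W F w) cl = satisfies (\<lambda>i. \<psi>s ! i \<in> w) cl"
      using F that canonical_clauses(3)[OF canonical assms(4,5)] assms(6)
      by (intro satisfies_cong[of _ "length \<psi>s"]) (blast, auto simp: truths_def ext_mem subset_iff)
    then show ?thesis using assms(8) that by blast
  qed
  ultimately have "Con c \<psi>s \<notin> w"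
    using assms(1,5,6) True unfolding respects_rules_def by blast
  then show ?thesis using True by simp
next
  case False
  show ?thesis
  proof
    assume "w \<in> ext W F (Con c \<psi>s)"
    then obtain S where S: "RightRule c S \<in> G" "forces_ext W F w \<psi>s S"
      using assms(4) False ext_Con by blast
    \<comment> \<open>Forcing at \<open>w\<close> covers \<open>w\<close> itself, so truth at
      \<open>w\<close> is a single classical assignment that satisfies the clauses of both
      rules.\<close>
    have "\<forall>cl\<in>S1 \<union> S2 \<union> S. satisfies (\<lambda>i. \<psi>s ! i \<in> truths W F w) cl"
      using assms(6,7,8) S(2) unfolding forces_ext_def by auto
    then show False
      using assms(3,5) S(1) unfolding coherent_def by blast
  qed
qed

text \<open>By persistence the context stays true above \<open>w\<close>, so only the instantiated
  clause can make the premise hold there.\<close>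

lemma holds_truths_union:
  assumes "w' \<in> W" "w \<subseteq> w'" "\<Gamma> \<subseteq> truths W F w" "holds (truths W F w') (\<Gamma> \<union> \<Pi>, E)"
  shows "holds (truths W F w') (\<Pi>, E)"
  using assms ext_mono unfolding holds_def truths_def by auto

lemma instance_holds_imp_satisfies:
  assumes "cl \<in> clauses n" "holds T (\<sigma> ` fst cl, map_option \<sigma> (snd cl))"
  shows "satisfies (\<lambda>i. map (\<sigma> \<circ> Atom) [0..<n] ! i \<in> T) cl"
proof -
  obtain \<Pi> E where cl: "cl = (\<Pi>, E)" by (cases cl)
  have *: "\<And>i. Atom i \<in> \<Pi> \<Longrightarrow> i < n" "\<Pi> \<subseteq> range Atom" "set_option E \<subseteq> Atom ` {..<n}"
    using assms(1) unfolding cl clauses_def by auto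
  show ?thesis
    using assms(2) * unfolding cl satisfies_def holds_def
    by (fastforce simp: image_iff)
qed

text \<open>The induction treats all worlds at once: for right rules and for the premises in
  \<open>S1\<close>, the induction hypothesis is applied at every world above
  \<open>w\<close>.\<close>

lemma soundness:
  assumes "respects_rules G W F" "closed_under_subformulas F" "coherent G"
    and hyps: "\<And>q w. q \<in> \<S> \<Longrightarrow> w \<in> W \<Longrightarrow> holds (truths W F w) q"
    and "derivable L G \<S> s" "w \<in> W"
  shows "holds (truths W F w) s"
  using assms(5,6)
proof (induction arbitrary: w)
  case (hyp s)
  then show ?case by (rule hyps)
next
  case (right c S n \<sigma> \<Gamma>)
  let ?\<psi>s = "map (\<sigma> \<circ> Atom) [0..<n]"
  have L: "L c = Some (length ?\<psi>s)" using right by simp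
  have \<sigma>: "\<sigma> (Con c (map Atom [0..<n])) = Con c ?\<psi>s"
    by (rule is_subst_Con[OF right.hyps(3,2)])
  have "forces_ext W F w ?\<psi>s S" if \<Gamma>: "\<Gamma> \<subseteq> truths W F w"
    unfolding forces_ext_def
  proof (intro ballI impI)
    fix cl w' assume cl: "cl \<in> S" and w': "w' \<in> W" "w \<subseteq> w'"
    have "holds (truths W F w') (\<Gamma> \<union> \<sigma> ` fst cl, map_option \<sigma> (snd cl))"
      using right.IH[of "fst cl" "snd cl" w'] cl w' by simp
    then have "holds (truths W F w') (\<sigma> ` fst cl, map_option \<sigma> (snd cl))"
      by (rule holds_truths_union[OF w' \<Gamma>])
    then show "satisfies (\<lambda>i. ?\<psi>s ! i \<in> truths W F w') cl"
      using cl canonical_clauses(1)[OF canonical right.hyps(2,1)]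
      by (intro instance_holds_imp_satisfies) auto
  qed
  then have "\<Gamma> \<subseteq> truths W F w \<Longrightarrow> w \<in> ext W F (Con c ?\<psi>s)"
    using ext_right_rule[OF assms(1,2) L right.hyps(1) right.prems] by blast
  then show ?case
    unfolding \<sigma> holds_def truths_def by (auto simp del: ext.simps)
next
  case (left c S1 S2 n \<sigma> \<Gamma> E)
  let ?\<psi>s = "map (\<sigma> \<circ> Atom) [0..<n]"
  have L: "L c = Some (length ?\<psi>s)" using left by simp
  have \<sigma>: "\<sigma> (Con c (map Atom [0..<n])) = Con c ?\<psi>s"
    by (rule is_subst_Con[OF left.hyps(3,2)])
  show ?case
  proof (rule ccontr)
    assume *: "\<not> ?case"
    then have \<Gamma>: "\<Gamma> \<subseteq> truths W F w" and E: "set_option E \<inter> truths W F w = {}"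
      and w: "w \<in> ext W F (Con c ?\<psi>s)"
      unfolding \<sigma> holds_def truths_def by auto
    have "forces_ext W F w ?\<psi>s S1"
      unfolding forces_ext_def
    proof (intro ballI impI)
      fix cl w' assume cl: "cl \<in> S1" and w': "w' \<in> W" "w \<subseteq> w'"
      have "holds (truths W F w') (\<Gamma> \<union> \<sigma> ` fst cl, map_option \<sigma> (snd cl))"
        using left.IH(1)[of "fst cl" "snd cl" w'] cl w' by simp
      then have "holds (truths W F w') (\<sigma> ` fst cl, map_option \<sigma> (snd cl))"
        by (rule holds_truths_union[OF w' \<Gamma>])
      then show "satisfies (\<lambda>i. ?\<psi>s ! i \<in> truths W F w') cl"
        using cl canonical_clauses(2)[OF canonical left.hyps(2,1)]
        by (intro instance_holds_imp_satisfies) auto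
    qed
    moreover have "satisfies (\<lambda>i. ?\<psi>s ! i \<in> truths W F w) cl" if cl: "cl \<in> S2" for cl
    proof -
      have None: "snd cl = None"
        using canonical_clauses(4)[OF canonical left.hyps(2,1)] cl by (cases cl) auto
      then have "holds (truths W F w) (\<Gamma> \<union> \<sigma> ` fst cl, E)"
        using left.IH(2)[of "fst cl" w] cl left.prems by (cases cl) simp
      \<comment> \<open>The context is true and \<open>E\<close> is false at \<open>w\<close>, so
        some member of the instantiated left-hand side must fail there.\<close>
      then have "holds (truths W F w) (\<sigma> ` fst cl, map_option \<sigma> (snd cl))"
        using \<Gamma> E None unfolding holds_def by auto
      then show ?thesis
        using cl canonical_clauses(3)[OF canonical left.hyps(2,1)]
        by (intro instance_holds_imp_satisfies) auto
    qed
    ultimately have "w \<notin> ext W F (Con c ?\<psi>s)"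
      using ext_left_rule[OF assms(1-3) L left.hyps(1) left.prems] by blast
    then show False using w by simp
  qed
next
  case (axiom \<phi>)
  then show ?case by (simp add: holds_def)
next
  case (weak_left \<Gamma> E \<Delta>)
  show ?case
    using weak_left.IH[OF weak_left.prems] unfolding holds_def by auto
next
  case (weak_right \<Gamma> \<psi>)
  show ?case
    using weak_right.IH[OF weak_right.prems] unfolding holds_def by auto
next
  case (cut \<Gamma> \<phi> \<Delta> E)
  show ?case
    using cut.IH(1,2)[OF cut.prems] unfolding holds_def by auto
qed

lemma holds_truths_iff:
  "seq_over F q \<Longrightarrow> w \<in> W \<Longrightarrow> holds (truths W F w) q \<longleftrightarrow> holds w q"
  unfolding holds_def truths_def seq_over_def by (auto simp: ext_mem subset_iff)

lemma countermodel_imp_not_derivable: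
  assumes "coherent G" "closed_under_subformulas F" "\<forall>q\<in>insert s \<S>. seq_over F q"
    "countermodel G \<S> s W F"
  shows "\<not> derivable L G \<S> s"
proof
  assume der: "derivable L G \<S> s"
  obtain w where w: "w \<in> W" "\<not> holds w s"
    using assms(4) by (auto simp: countermodel_def)
  have "holds (truths W F w) s"
  proof (rule soundness[OF _ assms(2,1) _ der w(1)])
    show "respects_rules G W F"
      using assms(4) by (simp add: countermodel_def)
    show "\<And>q w. q \<in> \<S> \<Longrightarrow> w \<in> W \<Longrightarrow> holds (truths W F w) q"
      using assms(3,4) by (simp add: countermodel_def holds_truths_iff)
  qed
  then show False
    using w assms(3) by (simp add: holds_truths_iff)
qed

section \<open>Maximal underivable sets and the canonical countermodel\<close>

text \<open>The single-conclusion analogue of a maximal consistent set: \<open>E\<close> is the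
  right-hand side to be avoided, and \<open>None\<close> amounts to consistency. Different worlds
  may avoid different right-hand sides.\<close>

definition maximal :: "seq set \<Rightarrow> fm set \<Rightarrow> fm set \<Rightarrow> fm option \<Rightarrow> bool" where
  "maximal \<S> F w E \<longleftrightarrow> w \<subseteq> F \<and> \<not> derivable L G \<S> (w, E) \<and>
     (\<forall>\<psi>\<in>F - w. derivable L G \<S> (insert \<psi> w, E))"

definition maximals :: "seq set \<Rightarrow> fm set \<Rightarrow> fm set set" where
  "maximals \<S> F = {w. \<exists>E. set_option E \<subseteq> F \<and> maximal \<S> F w E}"

text \<open>Lindenbaum's lemma; as \<open>F\<close> is finite, a maximal element among finitely many
  sets suffices.\<close>

lemma exists_maximal:
  assumes "finite F" "\<Gamma> \<subseteq> F" "\<not> derivable L G \<S> (\<Gamma>, E)"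
  shows "\<exists>w. \<Gamma> \<subseteq> w \<and> maximal \<S> F w E"
proof -
  let ?A = "{w. w \<subseteq> F \<and> \<not> derivable L G \<S> (w, E)}"
  have "finite ?A" using assms(1) by simp
  moreover have "\<Gamma> \<in> ?A" using assms by simp
  ultimately obtain w where w: "w \<in> ?A" "\<Gamma> \<subseteq> w" "\<forall>b\<in>?A. w \<subseteq> b \<longrightarrow> w = b"
    using finite_has_maximal2[of ?A \<Gamma>] by auto
  have "derivable L G \<S> (insert \<psi> w, E)" if "\<psi> \<in> F - w" for \<psi>
    using w(1) w(3)[THEN bspec, of "insert \<psi> w"] that by auto
  then show ?thesis using w by (auto simp: maximal_def)
qed

lemma weaken:
  assumes "derivable L G \<S> (\<Gamma>, E)" "\<Gamma> \<subseteq> \<Delta>" "finite \<Delta>" "\<Delta> \<subseteq> formulas L"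
  shows "derivable L G \<S> (\<Delta>, E)"
  using derivable.weak_left[OF assms(1,3,4)] assms(2) by (simp add: Un_absorb1)

context
  fixes \<S> :: "seq set" and F :: "fm set"
  assumes F: "finite F" "F \<subseteq> formulas L" "closed_under_subformulas F"
begin

text \<open>Here cut enters the construction: if \<phi> were missing, maximality would derive
  \<open>E\<close> from \<open>w\<close> and \<phi>, and cutting \<phi> would derive
  \<open>E\<close> from \<open>w\<close>.\<close>

lemma maximal_closed:
  assumes "maximal \<S> F w E" "derivable L G \<S> (w, Some \<phi>)" "\<phi> \<in> F"
  shows "\<phi> \<in> w"
proof (rule ccontr)
  assume "\<phi> \<notin> w"
  then have "derivable L G \<S> (insert \<phi> w, E)" using assms by (auto simp: maximal_def)
  from derivable.cut[OF assms(2) this] show False using assms(1) by (simp add: maximal_def)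
qed

lemma maximal_fails: "maximal \<S> F w (Some \<phi>) \<Longrightarrow> \<phi> \<in> F \<Longrightarrow> \<phi> \<notin> w"
  using weaken[OF derivable.axiom[of \<phi> L G \<S>], of w] F(1,2) finite_subset[of w F]
  unfolding maximal_def by (metis empty_subsetI insert_subset subsetD subset_trans)

text \<open>If the premise were underivable, its left-hand side would extend to a maximal set
  avoiding its right-hand side. That set is a larger world at which the clause fails.\<close>

lemma derivable_instance:
  assumes w: "w \<subseteq> F" and \<sigma>: "\<And>i. i < n \<Longrightarrow> \<sigma> (Atom i) \<in> F" and cl: "(\<Pi>, E) \<in> clauses n"
    and sat: "\<And>w'. w' \<in> maximals \<S> F \<Longrightarrow> w \<subseteq> w' \<Longrightarrow> satisfies (\<lambda>i. \<sigma> (Atom i) \<in> w') (\<Pi>, E)"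
  shows "derivable L G \<S> (w \<union> \<sigma> ` \<Pi>, map_option \<sigma> E)"
proof (rule ccontr)
  assume "\<not> ?thesis"
  moreover have \<Pi>: "\<sigma> ` \<Pi> \<subseteq> F" and E: "set_option (map_option \<sigma> E) \<subseteq> F"
    using \<sigma> cl by (auto simp: clauses_def)
  ultimately obtain w' where w': "w \<union> \<sigma> ` \<Pi> \<subseteq> w'" "maximal \<S> F w' (map_option \<sigma> E)"
    using exists_maximal[OF F(1), of "w \<union> \<sigma> ` \<Pi>"] w by (meson Un_least)
  then have "w' \<in> maximals \<S> F" using E by (auto simp: maximals_def)
  then have "satisfies (\<lambda>i. \<sigma> (Atom i) \<in> w') (\<Pi>, E)" using sat w' by blast
  then obtain i where "E = Some (Atom i)" "\<sigma> (Atom i) \<in> w'"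
    using w'(1) by (auto simp: satisfies_def)
  then show False using w'(2) E maximal_fails by auto
qed

text \<open>Forced premises are derivable, so the rule of the calculus applies. For a right rule,
  closure under derivability puts the conclusion into \<open>w\<close>; a left rule with its
  principal formula in \<open>w\<close> would derive the avoided right-hand side.\<close>

lemma respects_rules_maximals: "respects_rules G (maximals \<S> F) F"
  unfolding respects_rules_def
proof (intro ballI allI impI conjI notI)
  fix w c \<psi>s
  assume w: "w \<in> maximals \<S> F" and \<psi>s: "Con c \<psi>s \<in> F"
  then obtain E where E: "set_option E \<subseteq> F" "maximal \<S> F w E"
    by (auto simp: maximals_def)
  have w': "w \<subseteq> F" "finite w" "w \<subseteq> formulas L"
    using E F finite_subset by (auto simp: maximal_def)
  define n where "n = length \<psi>s"
  have L: "L c = Some n" and sub: "set \<psi>s \<subseteq> F"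
    using \<psi>s F by (auto simp: formulas_Con n_def closed_under_subformulas_def)
  \<comment> \<open>Atoms from \<open>n\<close> on are fixed because \<open>\<psi>s ! i\<close> is
    unspecified there and need not be a formula of the language.\<close>
  define \<sigma> where "\<sigma> = subst_atoms (\<lambda>i. if i < n then \<psi>s ! i else Atom i)"
  have \<sigma>: "is_subst L \<sigma>"
    unfolding \<sigma>_def using sub F(2)
    by (intro is_subst_subst_atoms) (auto simp: n_def formulas.Atom dest!: nth_mem)
  have \<sigma>_atom: "\<sigma> (Atom i) = \<psi>s ! i" if "i < n" for i
    using that by (simp add: \<sigma>_def)
  have \<sigma>_F: "\<sigma> (Atom i) \<in> F" if "i < n" for i
    using that sub by (auto simp: \<sigma>_atom n_def)
  have \<sigma>_con: "\<sigma> (Con c (map Atom [0..<n])) = Con c \<psi>s"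
    by (auto simp: \<sigma>_def n_def intro: nth_equalityI)
  have premise: "derivable L G \<S> (w \<union> \<sigma> ` \<Pi>, map_option \<sigma> E')"
    if "forces (maximals \<S> F) w \<psi>s S" "S \<subseteq> clauses n" "(\<Pi>, E') \<in> S" for S \<Pi> E'
  proof (rule derivable_instance[where n = n])
    show "w \<subseteq> F" by (rule w'(1))
    show "\<sigma> (Atom i) \<in> F" if "i < n" for i using that by (rule \<sigma>_F)
    show cl: "(\<Pi>, E') \<in> clauses n" using that by blast
    fix w' assume "w' \<in> maximals \<S> F" "w \<subseteq> w'"
    then have "satisfies (\<lambda>i. \<psi>s ! i \<in> w') (\<Pi>, E')"
      using that unfolding forces_def by blast
    then show "satisfies (\<lambda>i. \<sigma> (Atom i) \<in> w') (\<Pi>, E')"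
      using satisfies_cong[OF cl, of "\<lambda>i. \<sigma> (Atom i) \<in> w'"] \<sigma>_atom by simp
  qed
  {
    fix S assume S: "RightRule c S \<in> G" "forces (maximals \<S> F) w \<psi>s S"
    have "derivable L G \<S> (w, Some (\<sigma> (Con c (map Atom [0..<n]))))"
      using premise[OF S(2) canonical_clauses(1)[OF canonical L S(1)]]
      by (intro derivable.right[OF S(1) L \<sigma> w'(2,3)])
    then show "Con c \<psi>s \<in> w"
      unfolding \<sigma>_con using E \<psi>s maximal_closed by blast
  next
    fix S1 S2
    assume S: "LeftRule c S1 S2 \<in> G" "forces (maximals \<S> F) w \<psi>s S1"
      and S2: "\<forall>cl\<in>S2. satisfies (\<lambda>i. \<psi>s ! i \<in> w) cl" and in_w: "Con c \<psi>s \<in> w"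
    have "derivable L G \<S> (insert (\<sigma> (Con c (map Atom [0..<n]))) w, E)"
    proof (rule derivable.left[OF S(1) L \<sigma>])
      show "(w, E) \<in> sequents L" using w' E F(2) by (auto simp: sequents_def)
      show "derivable L G \<S> (w \<union> \<sigma> ` \<Pi>, map_option \<sigma> E')" if "(\<Pi>, E') \<in> S1" for \<Pi> E'
        using premise[OF S(2) canonical_clauses(2)[OF canonical L S(1)] that] .
      fix \<Sigma> assume \<Sigma>: "(\<Sigma>, None) \<in> S2"
      then have cl: "(\<Sigma>, None) \<in> clauses n"
        using canonical_clauses(3)[OF canonical L S(1)] by blast
      \<comment> \<open>A clause without right-hand side is satisfied through an atom made false. By
        maximality, adding the corresponding formula to \<open>w\<close> already derives
        \<open>E\<close>, and weakening gives the premise.\<close>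
      obtain i where i: "Atom i \<in> \<Sigma>" "\<psi>s ! i \<notin> w"
        using S2 \<Sigma> by (force simp: satisfies_def)
      have "i < n" using cl i by (auto simp: clauses_def)
      then have "\<psi>s ! i \<in> F - w" using i sub by (auto simp: n_def)
      then have "derivable L G \<S> (insert (\<psi>s ! i) w, E)" using E by (simp add: maximal_def)
      moreover have "\<psi>s ! i \<in> \<sigma> ` \<Sigma>" using i \<open>i < n\<close> \<sigma>_atom by (metis imageI)
      moreover have "\<sigma> ` \<Sigma> \<subseteq> F" using cl \<sigma>_F by (auto simp: clauses_def)
      ultimately show "derivable L G \<S> (w \<union> \<sigma> ` \<Sigma>, E)"
        using w' F(1,2) finite_subset[of "\<sigma> ` \<Sigma>" F]
        by (elim weaken) auto
    qed
    then show False
      \<comment> \<open>As the principal formula belongs to \<open>w\<close>, inserting it changes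
        nothing and \<open>w\<close> itself derives \<open>E\<close>.\<close>
      using in_w E(2) by (simp add: \<sigma>_con insert_absorb maximal_def)
  }
qed

text \<open>A world that contains the left-hand side of \<open>s\<close> and avoids its right-hand
  side refutes \<open>s\<close>. A hypothesis whose left-hand side lies in a world makes its
  right-hand side derivable from that world, hence a member of it.\<close>

lemma not_derivable_imp_countermodel:
  assumes "\<forall>q\<in>insert s \<S>. seq_over F q" "\<not> derivable L G \<S> s"
  shows "\<exists>W\<subseteq>Pow F. countermodel G \<S> s W F"
  unfolding countermodel_def
proof (intro exI[of _ "maximals \<S> F"] conjI ballI)
  show "maximals \<S> F \<subseteq> Pow F" by (auto simp: maximals_def maximal_def)
  show "respects_rules G (maximals \<S> F) F" by (rule respects_rules_maximals)
  obtain \<Gamma> E where s: "s = (\<Gamma>, E)" by (cases s)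
  have \<Gamma>: "\<Gamma> \<subseteq> F" and E: "set_option E \<subseteq> F"
    using assms(1) by (auto simp: s seq_over_def)
  obtain w where w: "\<Gamma> \<subseteq> w" "maximal \<S> F w E"
    using exists_maximal[OF F(1) \<Gamma>] assms(2) unfolding s by blast
  then have "w \<in> maximals \<S> F" using E by (auto simp: maximals_def)
  moreover have "\<not> holds w s"
    using w E maximal_fails unfolding s holds_def by (cases E) auto
  ultimately show "\<exists>w\<in>maximals \<S> F. \<not> holds w s" by blast
next
  fix w q
  assume "w \<in> maximals \<S> F" and q: "q \<in> \<S>"
  then obtain E where E: "set_option E \<subseteq> F" "maximal \<S> F w E"
    by (auto simp: maximals_def)
  obtain \<Gamma> E' where q': "q = (\<Gamma>, E')" by (cases q)
  show "holds w q"
  proof (cases "\<Gamma> \<subseteq> w")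
    case True
    then have der: "derivable L G \<S> (w, E')"
      using weaken[OF derivable.hyp[OF q[unfolded q'], of L G] True] E(2) F(1,2)
      by (meson finite_subset maximal_def subset_trans)
    show ?thesis
    proof (cases E')
      \<comment> \<open>The world avoids its own \<open>E\<close>, which right weakening would
        derive from the empty right-hand side.\<close>
      case None
      then have "derivable L G \<S> (w, E)"
        using der E F derivable.weak_right by (cases E) auto
      then show ?thesis using E by (simp add: maximal_def)
    next
      case (Some \<phi>)
      then have "\<phi> \<in> F" using assms(1) q by (auto simp: q' seq_over_def)
      then have "\<phi> \<in> w" using maximal_closed[OF E(2) der[unfolded Some]] by blast
      then show ?thesis by (simp add: q' holds_def Some)
    qed
  qed (auto simp: q' holds_def)
qed

end

end

section \<open>Searching for coded countermodels\<close>

text \<open>For a formula code, \<open>pfst\<close> is 0 at atoms and one more than the connective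
  otherwise, and \<open>psnd\<close> is then the coded argument list. For a sequent code,
  \<open>pfst\<close> is the coded left-hand side, and \<open>psnd\<close> is 0 or one more than the
  code of the right-hand formula.\<close>

abbreviation "pfst z \<equiv> fst (prod_decode z)"
abbreviation "psnd z \<equiv> snd (prod_decode z)"
abbreviation "arity_code a \<equiv> length (list_decode (psnd a))"

definition clause_code :: "nat \<Rightarrow> nat \<Rightarrow> bool" where
  "clause_code n q \<longleftrightarrow>
     (\<forall>a\<in>set_decode (pfst q). \<exists>i<n. a = prod_encode (0, i)) \<and>
     (psnd q = 0 \<or> (\<exists>i<n. psnd q = Suc (prod_encode (0, i))))"

text \<open>The code of an atom \<open>p\<^sub>i\<close> with \<open>i < n\<close> is below \<open>prod_encode (0, n)\<close>.\<close>

definition clauses_bound :: "nat \<Rightarrow> nat" where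
  "clauses_bound n = 2 ^ Suc (prod_encode (2 ^ prod_encode (0, n), prod_encode (0, n)))"

definition satisfies_code :: "nat \<Rightarrow> nat \<Rightarrow> nat \<Rightarrow> bool" where
  "satisfies_code l w q \<longleftrightarrow>
     (\<exists>i<length (list_decode l).
        prod_encode (0, i) \<in> set_decode (pfst q) \<and> nth_code l i \<notin> set_decode w) \<or>
     (\<exists>i<length (list_decode l).
        psnd q = Suc (prod_encode (0, i)) \<and> nth_code l i \<in> set_decode w)"

definition forces_code :: "nat \<Rightarrow> nat \<Rightarrow> nat \<Rightarrow> nat \<Rightarrow> bool" where
  "forces_code W w l S \<longleftrightarrow>
     (\<forall>q\<in>set_decode S. \<forall>w'\<in>set_decode W.
        (\<forall>a\<in>set_decode w. a \<in> set_decode w') \<longrightarrow> satisfies_code l w' q)"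

definition holds_code :: "nat \<Rightarrow> nat \<Rightarrow> bool" where
  "holds_code w q \<longleftrightarrow>
     (\<exists>a\<in>set_decode (pfst q). a \<notin> set_decode w) \<or>
     psnd q \<noteq> 0 \<and> psnd q - 1 \<in> set_decode w"

definition seq_over_code :: "nat \<Rightarrow> nat \<Rightarrow> bool" where
  "seq_over_code F q \<longleftrightarrow>
     (\<forall>a\<in>set_decode (pfst q). a \<in> set_decode F) \<and>
     (psnd q \<noteq> 0 \<longrightarrow> psnd q - 1 \<in> set_decode F)"

definition closed_code :: "nat \<Rightarrow> bool" where
  "closed_code F \<longleftrightarrow>
     (\<forall>a\<in>set_decode F. pfst a \<noteq> 0 \<longrightarrow>
        (\<forall>i<arity_code a.
           nth_code (psnd a) i \<in> set_decode F))"

definition clauses_code :: "nat \<Rightarrow> nat \<Rightarrow> bool" where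
  "clauses_code n S \<longleftrightarrow> (\<forall>q\<in>set_decode S. clause_code n q)"

text \<open>Here \<open>g\<close> decides membership in the system, but its values are meaningful only at codes of
  canonical rules, hence the guards in front of its applications.\<close>

definition right_rules_code :: "(nat \<Rightarrow> nat) \<Rightarrow> nat \<Rightarrow> nat \<Rightarrow> nat \<Rightarrow> bool" where
  "right_rules_code g W w a \<longleftrightarrow>
     (\<forall>S<clauses_bound (arity_code a).
        clauses_code (arity_code a) S \<longrightarrow>
        g (prod_encode (0, prod_encode (pfst a - 1, S))) = 1 \<longrightarrow>
        forces_code W w (psnd a) S \<longrightarrow> a \<in> set_decode w)"

definition left_rules_code :: "(nat \<Rightarrow> nat) \<Rightarrow> nat \<Rightarrow> nat \<Rightarrow> nat \<Rightarrow> bool" where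
  "left_rules_code g W w a \<longleftrightarrow>
     (\<forall>S1<clauses_bound (arity_code a).
      \<forall>S2<clauses_bound (arity_code a).
        clauses_code (arity_code a) S1 \<longrightarrow>
        clauses_code (arity_code a) S2 \<longrightarrow>
        (\<forall>q\<in>set_decode S2. psnd q = 0) \<longrightarrow>
        g (prod_encode (1, prod_encode (pfst a - 1, prod_encode (S1, S2)))) = 1 \<longrightarrow>
        forces_code W w (psnd a) S1 \<longrightarrow>
        (\<forall>q\<in>set_decode S2. satisfies_code (psnd a) w q) \<longrightarrow> a \<notin> set_decode w)"

text \<open>For a problem code \<open>x\<close>, the hypotheses are coded by \<open>pfst x\<close>
  and the goal by \<open>psnd x\<close>. The condition \<open>pfst a \<noteq> 0\<close> restricts
  the rule constraints to compound formulas.\<close>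

definition countermodel_code :: "(nat \<Rightarrow> nat) \<Rightarrow> nat \<Rightarrow> nat \<Rightarrow> nat \<Rightarrow> bool" where
  "countermodel_code g x W F \<longleftrightarrow>
     closed_code F \<and>
     seq_over_code F (psnd x) \<and>
     (\<forall>q\<in>set_decode (pfst x). seq_over_code F q) \<and>
     (\<forall>w\<in>set_decode W. \<forall>a\<in>set_decode F. pfst a \<noteq> 0 \<longrightarrow>
        right_rules_code g W w a \<and> left_rules_code g W w a) \<and>
     (\<forall>w\<in>set_decode W. \<forall>q\<in>set_decode (pfst x). holds_code w q) \<and>
     (\<exists>w\<in>set_decode W. \<not> holds_code w (psnd x))"

section \<open>Computability of the search\<close>

lemma computable_clause_code:
  "computable n f \<Longrightarrow> computable n g \<Longrightarrow> computable_pred n (\<lambda>xs. clause_code (f xs) (g xs))"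
proof (rule computable_compose2[where h = "\<lambda>a b. of_bool (clause_code a b)"])
  show "computable_pred 2 (\<lambda>xs. clause_code (xs ! 0) (xs ! 1))"
    unfolding clause_code_def by (rule computable_intros | simp)+
qed

lemma computable_clauses_bound:
  "computable n f \<Longrightarrow> computable n (\<lambda>xs. clauses_bound (f xs))"
  unfolding clauses_bound_def
  by (intro computable_pow computable_Suc computable_prod_encode computable_const)

lemma computable_satisfies_code:
  "computable n f \<Longrightarrow> computable n g \<Longrightarrow> computable n h \<Longrightarrow>
    computable_pred n (\<lambda>xs. satisfies_code (f xs) (g xs) (h xs))"
proof (rule computable_compose3[where h = "\<lambda>a b c. of_bool (satisfies_code a b c)"])
  show "computable_pred 3 (\<lambda>xs. satisfies_code (xs ! 0) (xs ! 1) (xs ! 2))"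
    unfolding satisfies_code_def by (rule computable_intros | simp)+
qed

lemma computable_forces_code:
  "computable n f \<Longrightarrow> computable n g \<Longrightarrow> computable n h \<Longrightarrow> computable n k \<Longrightarrow>
    computable_pred n (\<lambda>xs. forces_code (f xs) (g xs) (h xs) (k xs))"
proof (rule computable_compose4[where h = "\<lambda>a b c d. of_bool (forces_code a b c d)"])
  show "computable_pred 4 (\<lambda>xs. forces_code (xs ! 0) (xs ! 1) (xs ! 2) (xs ! 3))"
    unfolding forces_code_def by (rule computable_satisfies_code computable_intros | simp)+
qed

lemma computable_holds_code:
  "computable n f \<Longrightarrow> computable n g \<Longrightarrow> computable_pred n (\<lambda>xs. holds_code (f xs) (g xs))"
proof (rule computable_compose2[where h = "\<lambda>a b. of_bool (holds_code a b)"])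
  show "computable_pred 2 (\<lambda>xs. holds_code (xs ! 0) (xs ! 1))"
    unfolding holds_code_def by (rule computable_intros | simp del: One_nat_def)+
qed

lemma computable_seq_over_code:
  "computable n f \<Longrightarrow> computable n g \<Longrightarrow> computable_pred n (\<lambda>xs. seq_over_code (f xs) (g xs))"
proof (rule computable_compose2[where h = "\<lambda>a b. of_bool (seq_over_code a b)"])
  show "computable_pred 2 (\<lambda>xs. seq_over_code (xs ! 0) (xs ! 1))"
    unfolding seq_over_code_def by (rule computable_intros | simp del: One_nat_def)+
qed

lemma computable_closed_code:
  "computable n f \<Longrightarrow> computable_pred n (\<lambda>xs. closed_code (f xs))"
proof (rule computable_compose1[where h = "\<lambda>a. of_bool (closed_code a)"])
  show "computable_pred 1 (\<lambda>xs. closed_code (xs ! 0))"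
    unfolding closed_code_def by (rule computable_intros | simp)+
qed

lemma computable_clauses_code:
  "computable n f \<Longrightarrow> computable n g \<Longrightarrow> computable_pred n (\<lambda>xs. clauses_code (f xs) (g xs))"
proof (rule computable_compose2[where h = "\<lambda>a b. of_bool (clauses_code a b)"])
  show "computable_pred 2 (\<lambda>xs. clauses_code (xs ! 0) (xs ! 1))"
    unfolding clauses_code_def
    by (rule computable_clause_code computable_clauses_bound computable_intros | simp)+
qed

context
  fixes g :: "nat \<Rightarrow> nat"
  assumes g: "computable 1 (\<lambda>xs. g (xs ! 0))"
begin

lemmas computable_codes = computable_compose1[where h = g, OF g] computable_clauses_bound
  computable_satisfies_code computable_forces_code computable_holds_code
  computable_seq_over_code computable_closed_code computable_clauses_code

lemma computable_right_rules_code: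
  "computable n f1 \<Longrightarrow> computable n f2 \<Longrightarrow> computable n f3 \<Longrightarrow>
    computable_pred n (\<lambda>xs. right_rules_code g (f1 xs) (f2 xs) (f3 xs))"
proof (rule computable_compose3[where h = "\<lambda>a b c. of_bool (right_rules_code g a b c)"])
  show "computable_pred 3 (\<lambda>xs. right_rules_code g (xs ! 0) (xs ! 1) (xs ! 2))"
    unfolding right_rules_code_def
    by (rule computable_codes computable_intros | simp del: One_nat_def)+
qed

lemma computable_left_rules_code:
  "computable n f1 \<Longrightarrow> computable n f2 \<Longrightarrow> computable n f3 \<Longrightarrow>
    computable_pred n (\<lambda>xs. left_rules_code g (f1 xs) (f2 xs) (f3 xs))"
proof (rule computable_compose3[where h = "\<lambda>a b c. of_bool (left_rules_code g a b c)"])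
  show "computable_pred 3 (\<lambda>xs. left_rules_code g (xs ! 0) (xs ! 1) (xs ! 2))"
    unfolding left_rules_code_def
    by (rule computable_codes computable_intros | simp del: One_nat_def)+
qed

lemma computable_countermodel_code:
  "computable n f1 \<Longrightarrow> computable n f2 \<Longrightarrow> computable n f3 \<Longrightarrow>
    computable_pred n (\<lambda>xs. countermodel_code g (f1 xs) (f2 xs) (f3 xs))"
proof (rule computable_compose3[where h = "\<lambda>a b c. of_bool (countermodel_code g a b c)"])
  show "computable_pred 3 (\<lambda>xs. countermodel_code g (xs ! 0) (xs ! 1) (xs ! 2))"
    unfolding countermodel_code_def
    by (rule computable_codes computable_right_rules_code computable_left_rules_code
        computable_intros | simp del: One_nat_def)+
qed

text \<open>The formulas considered have codes below the problem code \<open>x\<close>. Thus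
  \<open>F\<close> and each of its subsets have codes below \<open>2 ^ x\<close>, and a family of
  such subsets has a code below \<open>2 ^ 2 ^ x\<close>.\<close>

lemma computable_exists_countermodel_code:
  "computable_pred 1 (\<lambda>xs. \<exists>F<2 ^ (xs ! 0). \<exists>W<2 ^ (2 ^ (xs ! 0)). countermodel_code g (xs ! 0) W F)"
  by (rule computable_countermodel_code computable_intros | simp del: One_nat_def)+

end

section \<open>Correspondence between codes and objects\<close>

lemma elem_le_list_encode: "a \<in> set as \<Longrightarrow> a \<le> list_encode as"
proof (induction as)
  case (Cons b as)
  then show ?case
    using le_prod_encode_1[of b "list_encode as"] le_prod_encode_2[of "list_encode as" b] by auto
qed simp

text \<open>The datatype \<open>fm\<close> ignores arities, so every number decodes to a possibly
  ill-formed formula. Coded sets of numbers can therefore be treated as sets of formulas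
  throughout.\<close>

lemma surj_fm_code: "\<exists>\<phi>. fm_code \<phi> = m"
proof (induction m rule: less_induct)
  case (less m)
  obtain k l where m: "m = prod_encode (k, l)" by (metis prod_decode_inverse surj_pair)
  show ?case
  proof (cases k)
    case 0
    then show ?thesis using m by (metis fm_code.simps(1))
  next
    case (Suc c)
    \<comment> \<open>The inequality is strict since the first component of the pair is positive;
      this makes the induction hypothesis applicable to the arguments.\<close>
    have "l < m"
      using Suc by (simp add: m prod_encode_def)
    have "\<exists>\<phi>. fm_code \<phi> = a" if "a \<in> set (list_decode l)" for a
      using elem_le_list_encode[OF that] \<open>l < m\<close> less by simp
    then have "map fm_code (map (inv fm_code) (list_decode l)) = list_decode l"
      by (auto simp: f_inv_into_f image_iff intro!: map_idI) (metis f_inv_into_f rangeI)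
    then show ?thesis
      using Suc m by (intro exI[of _ "Con c (map (inv fm_code) (list_decode l))"])
        (simp del: map_map)
  qed
qed

lemma set_encode_less: "A \<subseteq> {..<k} \<Longrightarrow> set_encode A < 2 ^ k"
proof -
  assume "A \<subseteq> {..<k}"
  then have "set_encode A \<le> (\<Sum>i<k. 2 ^ i)"
    unfolding set_encode_def by (intro sum_mono2) auto
  also have "\<dots> < 2 ^ k" by (induction k) auto
  finally show ?thesis .
qed

lemma triangle_less: "i < n \<Longrightarrow> triangle i < triangle n"
  by (rule lift_Suc_mono_less) simp_all

lemma prod_encode_mono: "a \<le> a' \<Longrightarrow> b \<le> b' \<Longrightarrow> prod_encode (a, b) \<le> prod_encode (a', b')"
proof -
  assume *: "a \<le> a'" "b \<le> b'"
  have "triangle (a + b) \<le> triangle (a' + b')"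
    using triangle_less[of "a + b" "a' + b'"] * by (cases "a + b = a' + b'") auto
  then show ?thesis using * by (simp add: prod_encode_def)
qed

lemma finite_clauses: "finite (clauses n)"
proof -
  have "clauses n \<subseteq> Pow (Atom ` {..<n}) \<times> insert None (Some ` Atom ` {..<n})"
    unfolding clauses_def by (auto simp: subset_iff) (metis imageI lessThan_iff not_None_eq)
  then show ?thesis by (rule finite_subset) simp
qed

lemma set_decode_seqs_code: "finite S \<Longrightarrow> set_decode (seqs_code S) = seq_code ` S"
  by (simp add: seqs_code_def)

lemma pfst_seq_code: "finite (fst q) \<Longrightarrow> set_decode (pfst (seq_code q)) = fm_code ` fst q"
  by (cases q) simp

lemma psnd_seq_code: "psnd (seq_code q) = (case snd q of None \<Rightarrow> 0 | Some \<phi> \<Rightarrow> Suc (fm_code \<phi>))"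
  by (cases q) simp

lemma finite_fst_clause: "cl \<in> clauses n \<Longrightarrow> finite (fst cl)"
  using clauses_finite[of "{cl}" n] by auto

lemma Atom_mem_clause_code:
  "cl \<in> clauses n \<Longrightarrow> prod_encode (0, i) \<in> set_decode (pfst (seq_code cl)) \<longleftrightarrow> Atom i \<in> fst cl"
  using inj_image_mem_iff[OF inj_fm_code, of "Atom i" "fst cl"]
  by (simp add: pfst_seq_code finite_fst_clause)

lemma Atom_eq_clause_code:
  "psnd (seq_code cl) = Suc (prod_encode (0, i)) \<longleftrightarrow> snd cl = Some (Atom i)"
  using injD[OF inj_fm_code, of _ "Atom i"]
  by (auto simp: psnd_seq_code split: option.splits)

lemma clause_code_iff: "clause_code n q \<longleftrightarrow> q \<in> seq_code ` clauses n"
proof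
  assume q: "clause_code n q"
  define \<Pi> where "\<Pi> = {Atom i |i. i < n \<and> prod_encode (0, i) \<in> set_decode (pfst q)}"
  have "fm_code ` \<Pi> = set_decode (pfst q)"
    using q by (force simp: \<Pi>_def clause_code_def image_iff)
  then have \<Pi>: "set_encode (fm_code ` \<Pi>) = pfst q" by simp
  have \<Pi>_sub: "\<Pi> \<subseteq> Atom ` {..<n}" by (auto simp: \<Pi>_def)
  consider "psnd q = 0" | i where "i < n" "psnd q = Suc (prod_encode (0, i))"
    using q by (auto simp: clause_code_def)
  then show "q \<in> seq_code ` clauses n"
  proof cases
    case 1
    then have "q = seq_code (\<Pi>, None)" using \<Pi> by simp (metis prod.collapse prod_decode_inverse)
    then show ?thesis using \<Pi>_sub by (auto simp: clauses_def simp del: seq_code.simps)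
  next
    case 2
    then have "q = seq_code (\<Pi>, Some (Atom i))"
      using \<Pi> by simp (metis prod.collapse prod_decode_inverse)
    then show ?thesis using \<Pi>_sub 2 by (auto simp: clauses_def simp del: seq_code.simps)
  qed
next
  assume "q \<in> seq_code ` clauses n"
  then obtain cl where cl: "cl \<in> clauses n" "q = seq_code cl" by blast
  then have "fst cl \<subseteq> Atom ` {..<n}" "set_option (snd cl) \<subseteq> Atom ` {..<n}"
    by (auto simp: clauses_def)
  then show "clause_code n q"
    using cl unfolding clause_code_def
    by (auto simp: pfst_seq_code finite_fst_clause psnd_seq_code split: option.splits)
qed

lemma clauses_code_iff: "clauses_code n m \<longleftrightarrow> (\<exists>S\<subseteq>clauses n. m = seqs_code S)"
proof
  assume "clauses_code n m"
  then have "set_decode m \<subseteq> seq_code ` clauses n"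
    by (auto simp: clauses_code_def clause_code_iff)
  then obtain S where S: "S \<subseteq> clauses n" "set_decode m = seq_code ` S"
    by (meson subset_image_iff)
  then have "m = seqs_code S" by (metis seqs_code_def set_decode_inverse)
  then show "\<exists>S\<subseteq>clauses n. m = seqs_code S" using S by blast
next
  assume "\<exists>S\<subseteq>clauses n. m = seqs_code S"
  then show "clauses_code n m"
    using finite_subset[OF _ finite_clauses]
    by (metis clauses_code_def clause_code_iff set_decode_seqs_code image_mono subsetD)
qed

text \<open>All atom codes are below \<open>?t\<close>, so a left-hand side has a code below
  \<open>2 ^ ?t\<close>, and a right-hand side contributes at most \<open>?t\<close>. Monotonicity
  of pairing bounds each clause code, and the \<open>Suc\<close> in \<open>clauses_bound\<close>
  makes that bound strict.\<close>

lemma seqs_code_less_clauses_bound: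
  assumes "S \<subseteq> clauses n"
  shows "seqs_code S < clauses_bound n"
  unfolding clauses_bound_def seqs_code_def
proof (rule set_encode_less, clarsimp simp only: lessThan_iff)
  fix \<Pi> E
  assume "(\<Pi>, E) \<in> S"
  then have "(\<Pi>, E) \<in> clauses n" using assms by blast
  then have *: "\<Pi> \<subseteq> Atom ` {..<n}" "set_option E \<subseteq> Atom ` {..<n}"
    by (auto simp: clauses_def)
  let ?t = "prod_encode (0, n)"
  have t: "prod_encode (0, i) < ?t" if "i < n" for i
    using triangle_less[OF that] by (simp add: prod_encode_def)
  have "set_encode (fm_code ` \<Pi>) < 2 ^ ?t"
    using * t by (intro set_encode_less) auto
  moreover have "(case E of None \<Rightarrow> 0 | Some \<phi> \<Rightarrow> Suc (fm_code \<phi>)) \<le> ?t"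
    using * t by (auto split: option.splits intro!: Suc_leI)
  ultimately show "seq_code (\<Pi>, E) < Suc (prod_encode (2 ^ ?t, ?t))"
    by (auto simp: less_Suc_eq_le intro: prod_encode_mono)
qed

definition decode_fms :: "nat \<Rightarrow> fm set" where
  "decode_fms m = fm_code -` set_decode m"

text \<open>Surjectivity of \<open>fm_code\<close> is essential from left to right: a number coding
  no formula would be invisible to \<open>decode_fms\<close>.\<close>

lemma decode_fms_subset_iff:
  "decode_fms m \<subseteq> decode_fms k \<longleftrightarrow> (\<forall>a\<in>set_decode m. a \<in> set_decode k)"
  unfolding decode_fms_def using surj_fm_code by (metis subsetD subsetI vimage_eq)

lemma decode_fms_set_encode: "finite F \<Longrightarrow> decode_fms (set_encode (fm_code ` F)) = F"
  by (simp add: decode_fms_def inj_vimage_image_eq[OF inj_fm_code])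

lemma satisfies_code_iff:
  assumes "cl \<in> clauses (length \<psi>s)"
  shows "satisfies_code (list_encode (map fm_code \<psi>s)) w (seq_code cl) \<longleftrightarrow>
    satisfies (\<lambda>i. \<psi>s ! i \<in> decode_fms w) cl"
proof -
  have "nth_code (list_encode (map fm_code \<psi>s)) i = fm_code (\<psi>s ! i)" if "i < length \<psi>s" for i
    using that nth_code[of i "list_encode (map fm_code \<psi>s)"] by simp
  moreover have "\<And>i. Atom i \<in> fst cl \<Longrightarrow> i < length \<psi>s"
    "\<And>i. snd cl = Some (Atom i) \<Longrightarrow> i < length \<psi>s"
    using assms by (auto simp: clauses_def)
  ultimately show ?thesis
    unfolding satisfies_code_def satisfies_def Atom_mem_clause_code[OF assms] Atom_eq_clause_code
    by (auto simp: decode_fms_def)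
qed

lemma forces_code_iff:
  assumes "S \<subseteq> clauses (length \<psi>s)"
  shows "forces_code W w (list_encode (map fm_code \<psi>s)) (seqs_code S) \<longleftrightarrow>
    forces (decode_fms ` set_decode W) (decode_fms w) \<psi>s S"
proof -
  have "finite S" using assms finite_clauses finite_subset by blast
  then show ?thesis
    using assms satisfies_code_iff
    unfolding forces_code_def forces_def decode_fms_subset_iff[symmetric]
    by (simp add: set_decode_seqs_code subset_eq del: seq_code.simps)
qed

lemma holds_code_iff:
  "finite (fst q) \<Longrightarrow> holds_code w (seq_code q) \<longleftrightarrow> holds (decode_fms w) q"
  unfolding holds_code_def holds_def
  by (auto simp: pfst_seq_code psnd_seq_code decode_fms_def split: option.splits)

lemma seq_over_code_iff:
  "finite (fst q) \<Longrightarrow> seq_over_code F (seq_code q) \<longleftrightarrow> seq_over (decode_fms F) q"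
  unfolding seq_over_code_def seq_over_def
  by (auto simp: pfst_seq_code psnd_seq_code decode_fms_def split: option.splits)

lemma closed_code_iff: "closed_code F \<longleftrightarrow> closed_under_subformulas (decode_fms F)"
proof -
  have "(pfst (fm_code \<phi>) \<noteq> 0 \<longrightarrow> (\<forall>i<arity_code (fm_code \<phi>). nth_code (psnd (fm_code \<phi>)) i \<in> set_decode F))
      \<longleftrightarrow> (\<forall>c \<psi>s. \<phi> = Con c \<psi>s \<longrightarrow> set \<psi>s \<subseteq> decode_fms F)" for \<phi>
  proof (cases \<phi>)
    case (Con c \<psi>s)
    have "nth_code (list_encode (map fm_code \<psi>s)) i = fm_code (\<psi>s ! i)" if "i < length \<psi>s" for i
      using that nth_code[of i "list_encode (map fm_code \<psi>s)"] by simp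
    then show ?thesis by (auto simp: Con decode_fms_def set_conv_nth)
  qed simp
  then show ?thesis
    unfolding closed_code_def closed_under_subformulas_def
    by (metis (mono_tags, lifting) decode_fms_def surj_fm_code vimage_eq)
qed

lemma sequents_iff: "q \<in> sequents L \<longleftrightarrow> finite (fst q) \<and> seq_over (formulas L) q"
  by (cases q) (auto simp: sequents_def seq_over_def)

text \<open>The numerical search over rules is exhaustive: every set of clauses of arity
  \<open>n\<close> has a code below the bound.\<close>

lemma clauses_code_all_iff:
  "(\<forall>m<clauses_bound n. clauses_code n m \<longrightarrow> P m) \<longleftrightarrow> (\<forall>S\<subseteq>clauses n. P (seqs_code S))"
  using seqs_code_less_clauses_bound unfolding clauses_code_iff by blast

section \<open>Correctness of the search\<close>

context
  fixes L :: language and G :: system and g :: "nat \<Rightarrow> nat"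
  assumes canonical: "canonical_system L G"
    and g: "\<And>r. canonical_rule L r \<Longrightarrow> g (rule_code r) = of_bool (r \<in> G)"
begin

lemma right_rules_code_iff:
  assumes "L c = Some (length \<psi>s)"
  shows "right_rules_code g W w (fm_code (Con c \<psi>s)) \<longleftrightarrow>
    (\<forall>S. RightRule c S \<in> G \<longrightarrow> forces (decode_fms ` set_decode W) (decode_fms w) \<psi>s S \<longrightarrow>
      Con c \<psi>s \<in> decode_fms w)"
proof -
  have "g (prod_encode (0, prod_encode (c, seqs_code S))) = 1 \<longleftrightarrow> RightRule c S \<in> G"
    if "S \<subseteq> clauses (length \<psi>s)" for S
    using g[of "RightRule c S"] that assms finite_subset[OF that finite_clauses] by simp
  then have "right_rules_code g W w (fm_code (Con c \<psi>s)) \<longleftrightarrow>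
    (\<forall>S\<subseteq>clauses (length \<psi>s). RightRule c S \<in> G \<longrightarrow>
      forces (decode_fms ` set_decode W) (decode_fms w) \<psi>s S \<longrightarrow> Con c \<psi>s \<in> decode_fms w)"
    by (simp add: right_rules_code_def clauses_code_all_iff forces_code_iff decode_fms_def)
  \<comment> \<open>Canonicity puts the clauses of every rule for \<open>c\<close> in
    \<open>G\<close> among those of its arity, so the search misses no rule.\<close>
  then show ?thesis
    using canonical_clauses(1)[OF canonical assms] by blast
qed

lemma left_rules_code_iff:
  assumes L: "L c = Some (length \<psi>s)"
  shows "left_rules_code g W w (fm_code (Con c \<psi>s)) \<longleftrightarrow>
    (\<forall>S1 S2. LeftRule c S1 S2 \<in> G \<longrightarrow>
      forces (decode_fms ` set_decode W) (decode_fms w) \<psi>s S1 \<longrightarrow>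
      (\<forall>cl\<in>S2. satisfies (\<lambda>i. \<psi>s ! i \<in> decode_fms w) cl) \<longrightarrow> Con c \<psi>s \<notin> decode_fms w)"
    (is "_ \<longleftrightarrow> (\<forall>S1 S2. _ \<longrightarrow> ?P S1 S2)")
proof -
  \<comment> \<open>If \<open>S2\<close> has only empty right-hand sides, the rule is canonical and
    \<open>g\<close> decides its membership. Otherwise both sides are false, whatever value
    \<open>g\<close> takes.\<close>
  have g': "(\<forall>q\<in>set_decode (seqs_code S2). psnd q = 0) \<and>
      g (prod_encode (1, prod_encode (c, prod_encode (seqs_code S1, seqs_code S2)))) = 1 \<longleftrightarrow>
      LeftRule c S1 S2 \<in> G"
    if "S1 \<subseteq> clauses (length \<psi>s)" "S2 \<subseteq> clauses (length \<psi>s)" for S1 S2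
  proof -
    have fin: "finite S1" "finite S2" using that finite_clauses finite_subset by blast+
    have "(\<forall>q\<in>set_decode (seqs_code S2). psnd q = 0) \<longleftrightarrow> (\<forall>(\<Sigma>, E)\<in>S2. E = None)"
      using fin by (auto simp: set_decode_seqs_code split: option.splits)
    moreover have "LeftRule c S1 S2 \<in> G \<Longrightarrow> \<forall>(\<Sigma>, E)\<in>S2. E = None"
      using canonical_clauses(4)[OF canonical L] by blast
    moreover have "g (prod_encode (1, prod_encode (c, prod_encode (seqs_code S1, seqs_code S2)))) = 1
        \<longleftrightarrow> LeftRule c S1 S2 \<in> G" if "\<forall>(\<Sigma>, E)\<in>S2. E = None"
    proof -
      have "canonical_rule L (LeftRule c S1 S2)"
        using that \<open>S1 \<subseteq> _\<close> \<open>S2 \<subseteq> _\<close> fin L by simp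
      from g[OF this] show ?thesis by (simp only: rule_code.simps of_bool_eq_1_iff)
    qed
    ultimately show ?thesis by blast
  qed
  have sat: "(\<forall>q\<in>set_decode (seqs_code S2). satisfies_code (list_encode (map fm_code \<psi>s)) w q) \<longleftrightarrow>
      (\<forall>cl\<in>S2. satisfies (\<lambda>i. \<psi>s ! i \<in> decode_fms w) cl)" if "S2 \<subseteq> clauses (length \<psi>s)" for S2
    using that satisfies_code_iff finite_subset[OF that finite_clauses]
    by (auto simp: set_decode_seqs_code subset_iff)
  have "left_rules_code g W w (fm_code (Con c \<psi>s)) \<longleftrightarrow>
      (\<forall>S1\<subseteq>clauses (length \<psi>s). \<forall>S2\<subseteq>clauses (length \<psi>s).
        (\<forall>q\<in>set_decode (seqs_code S2). psnd q = 0) \<longrightarrow>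
        g (prod_encode (1, prod_encode (c, prod_encode (seqs_code S1, seqs_code S2)))) = 1 \<longrightarrow>
        ?P S1 S2)"
  proof -
    \<comment> \<open>Moving the guard on \<open>S1\<close> in front of the quantifier over
      \<open>S2\<close> lets \<open>clauses_code_all_iff\<close> apply to each quantifier in
      turn.\<close>
    have swap: "(\<forall>m<b. \<forall>k<b. P m \<longrightarrow> Q m k) \<longleftrightarrow> (\<forall>m<b. P m \<longrightarrow> (\<forall>k<b. Q m k))" for b :: nat and P Q
      by blast
    show ?thesis
      by (simp add: left_rules_code_def swap clauses_code_all_iff forces_code_iff sat decode_fms_def)
  qed
  then show ?thesis
    using g' canonical_clauses(2,3)[OF canonical L] by (smt (verit, best))
qed

lemma countermodel_code_imp_not_derivable:
  assumes "coherent G" "finite \<S>" "\<S> \<subseteq> sequents L" "s \<in> sequents L"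
    and code: "countermodel_code g (problem_code (\<S>, s)) W F"
  shows "\<not> derivable L G \<S> s"
proof (rule countermodel_imp_not_derivable[OF canonical assms(1)])
  \<comment> \<open>Ill-formed members of the coded set are discarded, as \<open>g\<close> says
    nothing reliable about them. Well-formed formulas have well-formed arguments, so closure under
    subformulas survives.\<close>
  let ?F = "decode_fms F \<inter> formulas L" and ?W = "decode_fms ` set_decode W"
  have fin: "finite (fst q)" if "q \<in> insert s \<S>" for q
    using that assms(3,4) by (auto simp: sequents_iff)
  show "closed_under_subformulas ?F"
    using code
    by (auto simp: countermodel_code_def closed_code_iff closed_under_subformulas_def formulas_Con)
  have "seq_over (decode_fms F) q" if "q \<in> insert s \<S>" for q
    using code that fin[OF that]
    by (auto simp: countermodel_code_def set_decode_seqs_code assms(2) seq_over_code_iff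
        simp del: seq_code.simps)
  moreover have "seq_over (formulas L) q" if "q \<in> insert s \<S>" for q
    using that assms(3,4) by (auto simp: sequents_iff)
  ultimately show "\<forall>q\<in>insert s \<S>. seq_over ?F q" by (simp add: seq_over_def)
  have "respects_rules G ?W ?F"
    unfolding respects_rules_def
  proof (intro ballI allI impI)
    fix w' c \<psi>s assume "w' \<in> ?W" and \<psi>s: "Con c \<psi>s \<in> ?F"
    then obtain w where w: "w \<in> set_decode W" "w' = decode_fms w" by blast
    have L: "L c = Some (length \<psi>s)" using \<psi>s by (simp add: formulas_Con)
    have "fm_code (Con c \<psi>s) \<in> set_decode F" "pfst (fm_code (Con c \<psi>s)) \<noteq> 0"
      using \<psi>s by (simp_all add: decode_fms_def)
    then have "right_rules_code g W w (fm_code (Con c \<psi>s))"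
      "left_rules_code g W w (fm_code (Con c \<psi>s))"
      using w(1) code unfolding countermodel_code_def by blast+
    then show "(\<forall>S. RightRule c S \<in> G \<longrightarrow> forces ?W w' \<psi>s S \<longrightarrow> Con c \<psi>s \<in> w') \<and>
        (\<forall>S1 S2. LeftRule c S1 S2 \<in> G \<longrightarrow> forces ?W w' \<psi>s S1 \<longrightarrow>
           (\<forall>cl\<in>S2. satisfies (\<lambda>i. \<psi>s ! i \<in> w') cl) \<longrightarrow> Con c \<psi>s \<notin> w')"
      unfolding right_rules_code_iff[OF L] left_rules_code_iff[OF L] w(2) by blast
  qed
  moreover have "\<forall>w\<in>?W. \<forall>q\<in>\<S>. holds w q" "\<exists>w\<in>?W. \<not> holds w s"
    using code fin
    by (auto simp: countermodel_code_def set_decode_seqs_code assms(2) holds_code_iff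
        simp del: seq_code.simps)
  ultimately show "countermodel G \<S> s ?W ?F" by (simp add: countermodel_def)
qed

lemma not_derivable_imp_countermodel_code:
  assumes "finite \<S>" "\<S> \<subseteq> sequents L" "s \<in> sequents L" and "\<not> derivable L G \<S> s"
    and x: "x = problem_code (\<S>, s)"
  shows "\<exists>F<2 ^ x. \<exists>W<2 ^ 2 ^ x. countermodel_code g x W F"
proof -
  have fin: "finite (fst q)" if "q \<in> insert s \<S>" for q
    using that assms(2,3) by (auto simp: sequents_iff)
  \<comment> \<open>All formulas of \<open>L\<close> with code below \<open>x\<close>. This set need
    not be computed from \<open>x\<close>: it is enough that it has some code below the search
    bound.\<close>
  define F where "F = {\<phi> \<in> formulas L. fm_code \<phi> < x}"
  have "F \<subseteq> fm_code -` {..<x}" by (auto simp: F_def)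
  then have finF: "finite F"
    by (rule finite_subset) (auto intro: finite_vimageI inj_fm_code)
  have F_sub: "F \<subseteq> formulas L" by (auto simp: F_def)
  have closed: "closed_under_subformulas F"
    unfolding closed_under_subformulas_def
  proof (intro allI impI subsetI)
    fix c \<psi>s \<psi> assume *: "Con c \<psi>s \<in> F" "\<psi> \<in> set \<psi>s"
    have "fm_code \<psi> \<le> list_encode (map fm_code \<psi>s)"
      using *(2) by (intro elem_le_list_encode) simp
    also have "\<dots> \<le> fm_code (Con c \<psi>s)" by (simp add: le_prod_encode_2)
    finally show "\<psi> \<in> F" using * by (auto simp: F_def formulas_Con)
  qed
  have "seq_code q \<le> x" if "q \<in> insert s \<S>" for q
  proof (cases "q = s")
    case True
    then show ?thesis by (simp add: x le_prod_encode_2 del: seq_code.simps)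
  next
    case False
    then have "seq_code q \<in> set_decode (seqs_code \<S>)"
      using that by (simp add: set_decode_seqs_code assms(1) del: seq_code.simps)
    then have "seq_code q < seqs_code \<S>" by (rule set_decode_less)
    also have "\<dots> \<le> x" by (simp add: x le_prod_encode_1 del: seq_code.simps)
    finally show ?thesis by simp
  qed
  \<comment> \<open>Strictness comes from \<open>set_decode_less\<close> on the left of the sequent
    and from the \<open>Suc\<close> in \<open>seq_code\<close> on the right.\<close>
  moreover have "fm_code \<phi> < seq_code q"
    if "q \<in> insert s \<S>" "\<phi> \<in> fst q \<or> snd q = Some \<phi>" for q \<phi>
  proof (cases "\<phi> \<in> fst q")
    case True
    then have "fm_code \<phi> < pfst (seq_code q)"
      using fin[OF that(1)] set_decode_less pfst_seq_code by blast
    also have "\<dots> \<le> seq_code q" by (metis le_prod_encode_1 prod.collapse prod_decode_inverse)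
    finally show ?thesis .
  next
    case False
    then have "fm_code \<phi> < psnd (seq_code q)" using that by (simp add: psnd_seq_code)
    also have "\<dots> \<le> seq_code q" by (metis le_prod_encode_2 prod.collapse prod_decode_inverse)
    finally show ?thesis .
  qed
  ultimately have less: "fm_code \<phi> < x"
    if "q \<in> insert s \<S>" "\<phi> \<in> fst q \<or> snd q = Some \<phi>" for q \<phi>
    using that less_le_trans by blast
  have over: "seq_over F q" if "q \<in> insert s \<S>" for q
  proof -
    have "seq_over (formulas L) q" using that assms(2,3) by (auto simp: sequents_iff)
    then show ?thesis
      using less[OF that] by (auto simp: seq_over_def F_def)
  qed
  have "\<forall>q\<in>insert s \<S>. seq_over F q" using over ..
  then obtain W where W: "W \<subseteq> Pow F" "countermodel G \<S> s W F"
    using not_derivable_imp_countermodel[OF canonical finF F_sub closed _ assms(4)] by auto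
  define F' where "F' = set_encode (fm_code ` F)"
  define W' where "W' = set_encode ((\<lambda>w. set_encode (fm_code ` w)) ` W)"
  have finW: "finite W" "\<And>w. w \<in> W \<Longrightarrow> finite w"
    using W(1) finF by (auto intro: finite_subset)
  have F': "decode_fms F' = F" by (simp add: F'_def finF decode_fms_set_encode)
  have W': "decode_fms ` set_decode W' = W"
    using finW by (simp add: W'_def image_image decode_fms_set_encode)
  have "F' < 2 ^ x"
    unfolding F'_def by (rule set_encode_less) (auto simp: F_def)
  moreover have "W' < 2 ^ 2 ^ x"
    unfolding W'_def using W(1)
    by (intro set_encode_less) (auto intro!: set_encode_less simp: F_def subset_iff)
  moreover have "countermodel_code g x W' F'"
    unfolding countermodel_code_def
  proof (intro conjI ballI impI)
    have hyps: "set_decode (pfst x) = seq_code ` \<S>" and goal: "psnd x = seq_code s"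
      by (simp_all add: x set_decode_seqs_code assms(1))
    show "closed_code F'" by (simp add: closed_code_iff F' closed)
    show "seq_over_code F' (psnd x)"
      unfolding goal using fin[of s] over[of s] by (simp add: seq_over_code_iff F' del: seq_code.simps)
    show "seq_over_code F' q" if q: "q \<in> set_decode (pfst x)" for q
    proof -
      obtain p where "p \<in> \<S>" "q = seq_code p" using q unfolding hyps by blast
      then show ?thesis
        using fin[of p] over[of p] by (simp add: seq_over_code_iff F' del: seq_code.simps)
    qed
    have holds: "\<forall>w\<in>set_decode W'. \<forall>q\<in>\<S>. holds (decode_fms w) q"
      "\<exists>w\<in>set_decode W'. \<not> holds (decode_fms w) s"
      using W(2) unfolding countermodel_def W'[symmetric] by simp_all
    show "holds_code w q" if w: "w \<in> set_decode W'" and q: "q \<in> set_decode (pfst x)" for w q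
    proof -
      obtain p where "p \<in> \<S>" "q = seq_code p" using q unfolding hyps by blast
      then show ?thesis
        using fin[of p] holds(1) w by (simp add: holds_code_iff del: seq_code.simps)
    qed
    show "\<exists>w\<in>set_decode W'. \<not> holds_code w (psnd x)"
      unfolding goal using fin[of s] holds(2) by (simp add: holds_code_iff del: seq_code.simps)
    fix w a assume w: "w \<in> set_decode W'" and a: "a \<in> set_decode F'" "pfst a \<noteq> 0"
    obtain \<phi> where \<phi>: "a = fm_code \<phi>" using surj_fm_code[of a] by metis
    then obtain c \<psi>s where Con: "\<phi> = Con c \<psi>s" using a(2) by (cases \<phi>) auto
    have "\<phi> \<in> F" using a(1) F' by (auto simp: \<phi> decode_fms_def)
    then have L: "L c = Some (length \<psi>s)" by (simp add: F_def Con formulas_Con)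
    have "respects_rules G (decode_fms ` set_decode W') F"
      using W(2) by (simp add: W' countermodel_def)
    then show "right_rules_code g W' w a" "left_rules_code g W' w a"
      using \<open>\<phi> \<in> F\<close> w unfolding \<phi> Con right_rules_code_iff[OF L] left_rules_code_iff[OF L]
        respects_rules_def by blast+
  qed
  ultimately show ?thesis by blast
qed

end

section \<open>The decision procedure\<close>

theorem theorem7p4:
  fixes L :: language and G :: system
  assumes "canonical_system L G"
    and "effective L G"
    and "coherent G"
  shows "strongly_decidable L G"
proof -
  obtain f where f: "recursive 1 f"
    "\<And>r. canonical_rule L r \<Longrightarrow> f [rule_code r] = of_bool (r \<in> G)"
    using assms(2) by (auto simp: effective_def decidable_on_def)
  define g where "g m = f [m]" for m
  have "computable 1 (\<lambda>xs. g (xs ! 0))"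
    by (rule computable_cong[OF computable_recursive[OF f(1)]])
      (auto simp: g_def length_Suc_conv)
  \<comment> \<open>The search succeeds exactly on the underivable problems, so its negation is the
    decision function.\<close>
  from computable_not[OF computable_exists_countermodel_code[OF this]]
  obtain h where h: "recursive 1 h" and
    h_eq: "\<And>xs. length xs = 1 \<Longrightarrow> h xs = of_bool (\<not> (\<exists>F<2 ^ (xs ! 0). \<exists>W<2 ^ 2 ^ (xs ! 0).
      countermodel_code g (xs ! 0) W F))"
    unfolding computable_def by blast
  have g: "\<And>r. canonical_rule L r \<Longrightarrow> g (rule_code r) = of_bool (r \<in> G)"
    using f(2) by (simp add: g_def)
  have "h [problem_code (\<S>, s)] = of_bool (derivable L G \<S> s)"
    if "finite \<S>" "\<S> \<subseteq> sequents L" "s \<in> sequents L" for \<S> s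
  proof -
    let ?x = "problem_code (\<S>, s)"
    have "(\<exists>F<2 ^ ?x. \<exists>W<2 ^ 2 ^ ?x. countermodel_code g ?x W F) \<longleftrightarrow> \<not> derivable L G \<S> s"
      using countermodel_code_imp_not_derivable[OF assms(1) g assms(3) that]
        not_derivable_imp_countermodel_code[OF assms(1) g that _ refl] by blast
    then show ?thesis
      using h_eq[of "[?x]"] by (simp del: problem_code.simps)
  qed
  then show ?thesis
    using h by (auto simp: strongly_decidable_def decidable_on_def simp del: problem_code.simps)
qed

end
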